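(* For each constant $C$ there exists $n_0$ such that for all $n\ge n_0$ and all integers $j$ with $|j-\mu|\le C\sigma$, $$c_j^2\ge c_{j-1}c_{j+1},$$ where $c_j=[q^j]\binom{2n}{n}_q$, $\mu=n^2/2$ and $\sigma^2=\frac{n^2(2n+1)}{12}$.
   Context: The $q$-binomial coefficient is $\binom{2n}{n}_q=\frac{(1-q^{2n})(1-q^{2n-1})\cdots(1-q^{n+1})}{(1-q^n)(1-q^{n-1})\cdots(1-q)}$, a polynomial in $q$; $[q^j]P$ denotes the coefficient of $q^j$ in $P$ (zero if $j<0$ or $j>n^2$). Equivalently $c_j$ is the number of words with $n$ letters $1$ and $n$ letters $2$ having exactly $j$ inversions; $\mu$ and $\sigma^2$ are the mean and variance of the number of inversions of such a uniformly random word. *)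

theory Defs
  imports Complex_Main "HOL-Computational_Algebra.Polynomial"
begin

text \<open>
  The Gaussian binomial coefficient as a quotient of products in the indeterminate
  \<open>q = monom 1 1\<close>. For \<open>N = 2 * n\<close> and \<open>k = n\<close> the numerator has the factors
  \<open>1 - q^(2n), \<dots>, 1 - q^(n+1)\<close> and the denominator \<open>1 - q^n, \<dots>, 1 - q\<close>.
  The division is polynomial division; it is exact by \<open>qbinomial_times_denominator\<close> below.
\<close>

definition qbinomial :: "nat \<Rightarrow> nat \<Rightarrow> int poly" where
  "qbinomial N k =
     (\<Prod>i<k. 1 - monom 1 (N - i)) div (\<Prod>i<k. 1 - monom 1 (k - i))"

text \<open>Indices are integers, so that the coefficient with index \<open>j - 1\<close> is \<open>0\<close> for \<open>j = 0\<close>.\<close>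

definition central_qcoeff :: "nat \<Rightarrow> int \<Rightarrow> int" where
  "central_qcoeff n j = (if j < 0 then 0 else coeff (qbinomial (2 * n) n) (nat j))"

text \<open>
  Closed forms for the mean and the variance of the number of inversions of a uniformly
  random word with \<open>n\<close> letters \<open>1\<close> and \<open>n\<close> letters \<open>2\<close>.
\<close>

definition inv_mean :: "nat \<Rightarrow> real" where
  "inv_mean n = (real n)\<^sup>2 / 2"

definition inv_variance :: "nat \<Rightarrow> real" where
  "inv_variance n = (real n)\<^sup>2 * (2 * real n + 1) / 12"

definition inv_sd :: "nat \<Rightarrow> real" where
  "inv_sd n = sqrt (inv_variance n)"

lemma qbinomial_denominator_dvd:
  "(\<Prod>i<k. 1 - monom (1::int) (k - i)) dvd (\<Prod>i<k. 1 - monom 1 (N - i))"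
proof (induction N arbitrary: k)
  case 0
  show ?case by (cases k) (auto simp: prod.lessThan_Suc_shift one_pCons monom_0)
next
  case (Suc N)
  let ?num = "\<lambda>N k. \<Prod>i<k. 1 - monom (1::int) (N - i)"
  show ?case
  proof (cases k)
    case 0
    then show ?thesis by simp
  next
    case k: (Suc m)
    have shift: "?num (Suc M) (Suc m) = (1 - monom 1 (Suc M)) * ?num M m" for M
      by (subst prod.lessThan_Suc_shift) simp
    show ?thesis
    proof (cases "m \<le> N")
      case True
      have "monom (1::int) (Suc m) * monom 1 (N - m) = monom 1 (Suc N)"
        using True by (simp add: mult_monom)
      then have "(1 - monom 1 (Suc N) :: int poly)
          = (1 - monom 1 (Suc m)) + monom 1 (Suc m) * (1 - monom 1 (N - m))"
        by (simp add: algebra_simps)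
      then have "?num (Suc N) (Suc m)
          = (1 - monom 1 (Suc m)) * ?num N m + monom 1 (Suc m) * ?num N (Suc m)"
        by (simp only: shift) (simp add: algebra_simps)
      moreover have "?num (Suc m) (Suc m) dvd (1 - monom 1 (Suc m)) * ?num N m"
        unfolding shift by (intro mult_dvd_mono Suc.IH dvd_refl)
      moreover have "?num (Suc m) (Suc m) dvd monom 1 (Suc m) * ?num N (Suc m)"
        by (intro dvd_mult Suc.IH)
      ultimately show ?thesis
        unfolding k by (metis dvd_add)
    next
      case False
      then have "?num (Suc N) (Suc m) = 0"
        by (intro prod_zero) (auto intro!: bexI[of _ "Suc N"] simp: one_pCons monom_0)
      then show ?thesis unfolding k by (simp only: dvd_0_right)
    qed
  qed
qed

lemma qbinomial_times_denominator:
  "qbinomial N k * (\<Prod>i<k. 1 - monom 1 (k - i)) = (\<Prod>i<k. 1 - monom 1 (N - i))"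
  unfolding qbinomial_def by (intro dvd_div_mult_self qbinomial_denominator_dvd)

end

theory Submission
  imports Defs "HOL-Probability.Probability" "HOL-Real_Asymp.Real_Asymp"
begin

text \<open>
  The coefficient \<open>c\<^sub>j\<close> is a Fourier integral of \<open>\<phi>(\<theta>)\<close>, the value of the \<open>q\<close>-binomial coefficient at
  \<open>q = cis \<theta>\<close>, centred at the mean. For \<open>\<bar>\<theta>\<bar> < \<pi>/n\<close> the product formula writes the normalised \<open>\<phi>\<close> as a
  product of quotients \<open>(sin u / u) / (sin v / v)\<close>. Since \<open>ln (sin u / u) + u\<^sup>2/6\<close> decreases on \<open>(0, \<pi>)\<close>,
  \<open>\<phi>\<close> is at most the Gaussian of variance \<open>\<sigma>\<^sup>2\<close>, and it is asymptotic to it at \<open>\<theta> = t/\<sigma>\<close>.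
  For \<open>\<pi>/n \<le> \<bar>\<theta>\<bar> \<le> \<pi>\<close> the \<open>q\<close>-binomial theorem makes \<open>\<phi>\<close> exponentially small.
  By dominated convergence the rescaled \<open>\<phi>\<close> converges to \<open>exp (- t\<^sup>2/2)\<close> in \<open>L\<^sup>1\<close> with weight \<open>1 + t\<^sup>2\<close>. This
  controls \<open>c\<^sub>j\<close> together with its first and second differences, taken with step \<open>h = 1/\<sigma>\<close>, so \<open>c\<^sub>j\<close> inherits
  the strict log-concavity of the Gaussian, whose gap is of order \<open>h\<^sup>2\<close>, on every window \<open>\<bar>j - \<mu>\<bar> \<le> C \<sigma>\<close>.
\<close>

section \<open>The q-binomial theorem and Fourier coefficients\<close>

definition ipoly :: "int poly \<Rightarrow> complex \<Rightarrow> complex" where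
  "ipoly p z = poly (map_poly of_int p) z"

lemma ipoly_0 [simp]: "ipoly 0 z = 0"
  and ipoly_1 [simp]: "ipoly 1 z = 1"
  and ipoly_monom [simp]: "ipoly (monom c n) z = of_int c * z ^ n"
  by (simp_all add: ipoly_def map_poly_monom poly_monom)

lemma ipoly_pCons [simp]: "ipoly (pCons c p) z = of_int c + z * ipoly p z"
  by (simp add: ipoly_def map_poly_pCons)

lemma ipoly_add [simp]: "ipoly (p + r) z = ipoly p z + ipoly r z"
proof -
  have "map_poly of_int (p + r) = (map_poly of_int p + map_poly of_int r :: complex poly)"
    by (intro poly_eqI) (simp add: coeff_map_poly)
  then show ?thesis by (simp add: ipoly_def)
qed

lemma ipoly_diff [simp]: "ipoly (p - r) z = ipoly p z - ipoly r z"
  using ipoly_add[of "p - r" r z] by simp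

lemma ipoly_smult [simp]: "ipoly (smult c p) z = of_int c * ipoly p z"
  by (simp add: ipoly_def map_poly_smult)

lemma ipoly_mult [simp]: "ipoly (p * r) z = ipoly p z * ipoly r z"
  by (induction p) (simp_all add: algebra_simps)

lemma ipoly_prod [simp]: "ipoly (\<Prod>i\<in>A. f i) z = (\<Prod>i\<in>A. ipoly (f i) z)"
  by (induction A rule: infinite_finite_induct) simp_all

lemma ipoly_altdef: "ipoly p z = (\<Sum>i\<le>degree p. of_int (coeff p i) * z ^ i)"
  by (simp add: ipoly_def poly_altdef degree_map_poly coeff_map_poly)

section \<open>The q-Pascal rule and the q-binomial theorem\<close>

lemma qbinomial_denominator_nonzero: "(\<Prod>i<k. 1 - monom (1::int) (k - i)) \<noteq> 0"
proof -
  have "1 - monom (1::int) (k - i) \<noteq> 0" if "i < k" for i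
  proof
    assume "1 - monom (1::int) (k - i) = 0"
    \<comment> \<open>The constant coefficient is \<open>1\<close>, because \<open>k - i\<close> is
      positive.\<close>
    then have "coeff (1 - monom (1::int) (k - i)) 0 = 0" by simp
    with that show False by simp
  qed
  then show ?thesis by simp
qed

lemma qbinomial_0_right [simp]: "qbinomial N 0 = 1"
  by (simp add: qbinomial_def)

lemma qbinomial_eq_0: "N < k \<Longrightarrow> qbinomial N k = 0"
proof -
  assume "N < k"
  \<comment> \<open>The factor with index \<open>N\<close> is \<open>1 - monom 1 0\<close>, which is
    zero.\<close>
  then have "(\<Prod>i<k. 1 - monom (1::int) (N - i)) = 0"
    by (intro prod_zero) (auto intro!: bexI[of _ N])
  then show ?thesis unfolding qbinomial_def by (simp only: div_0)
qed

text \<open>The q-Pascal rule. For \<open>k \<le> N\<close>, multiplying by the denominator reduces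
  it to the splitting \<open>1 - q^(N+1) = (1 - q^(k+1)) + q^(k+1) * (1 - q^(N-k))\<close>.\<close>

lemma qbinomial_Suc_Suc:
  "qbinomial (Suc N) (Suc k) = qbinomial N k + monom 1 (Suc k) * qbinomial N (Suc k)"
proof (cases "k \<le> N")
  case True
  let ?num = "\<lambda>N k. \<Prod>i<k. 1 - monom (1::int) (N - i)"
  have shift: "?num (Suc M) (Suc m) = (1 - monom 1 (Suc M)) * ?num M m" for M m
    by (subst prod.lessThan_Suc_shift) simp
  have "monom (1::int) (Suc k) * monom 1 (N - k) = monom 1 (Suc N)"
    using True by (simp add: mult_monom)
  then have split: "(1 - monom 1 (Suc N) :: int poly)
      = (1 - monom 1 (Suc k)) + monom 1 (Suc k) * (1 - monom 1 (N - k))"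
    by (simp add: algebra_simps)
  have "(qbinomial N k + monom 1 (Suc k) * qbinomial N (Suc k)) * ?num (Suc k) (Suc k)
      = (1 - monom 1 (Suc k)) * (qbinomial N k * ?num k k)
        + monom 1 (Suc k) * (qbinomial N (Suc k) * ?num (Suc k) (Suc k))"
    by (simp only: shift) (simp add: algebra_simps)
  also have "\<dots> = (1 - monom 1 (Suc k)) * ?num N k + monom 1 (Suc k) * ?num N (Suc k)"
    by (simp only: qbinomial_times_denominator)
  also have "\<dots> = (1 - monom 1 (Suc N)) * ?num N k"
  proof -
    have "?num N (Suc k) = ?num N k * (1 - monom 1 (N - k))"
      by simp
    then show ?thesis
      by (simp only: split) (simp only: algebra_simps)
  qed
  also have "\<dots> = qbinomial (Suc N) (Suc k) * ?num (Suc k) (Suc k)"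
    by (metis qbinomial_times_denominator shift)
  finally show ?thesis
    using qbinomial_denominator_nonzero[of "Suc k"] mult_right_cancel by metis
next
  case False
  then show ?thesis by (simp add: qbinomial_eq_0)
qed

text \<open>Peeling off the factor with \<open>i = 0\<close> replaces \<open>z\<close> by
  \<open>z * q\<close> in the rest, and the q-Pascal rule recombines the two resulting sums. Each
  q-binomial is thus, up to a power of \<open>q\<close>, a coefficient in \<open>z\<close> of an
  explicit product, which can be bounded even where the quotient formula has vanishing
  denominators.\<close>

theorem q_binomial_theorem:
  "(\<Prod>i<N. 1 + z * q ^ i) = (\<Sum>k\<le>N. q ^ (k choose 2) * ipoly (qbinomial N k) q * z ^ k)"
proof (induction N arbitrary: z)
  case 0
  show ?case by (simp add: numeral_2_eq_2)
next
  case (Suc N)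
  define f where "f k = q ^ (k choose 2) * ipoly (qbinomial N k) q * (z * q) ^ k" for k
  have eq: "q ^ (Suc k choose 2) * ipoly (qbinomial (Suc N) (Suc k)) q * z ^ Suc k
      = f (Suc k) + z * f k" for k
    by (simp add: f_def qbinomial_Suc_Suc numeral_2_eq_2 power_add algebra_simps power_mult_distrib)
  have "(\<Prod>i<Suc N. 1 + z * q ^ i) = (1 + z) * (\<Prod>i<N. 1 + (z * q) * q ^ i)"
    by (subst prod.lessThan_Suc_shift) (simp add: mult.assoc)
  also have "\<dots> = (1 + z) * (\<Sum>k\<le>N. f k)"
    by (subst Suc.IH) (simp add: f_def)
  \<comment> \<open>The range can grow to \<open>Suc N\<close> because
    \<open>qbinomial N (Suc N) = 0\<close>.\<close>
  also have "\<dots> = (\<Sum>k\<le>Suc N. f k) + (\<Sum>k\<le>N. z * f k)"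
    by (simp add: f_def qbinomial_eq_0 distrib_right sum.distrib sum_distrib_left)
  also have "\<dots> = f 0 + (\<Sum>k\<le>N. f (Suc k) + z * f k)"
    by (subst sum.atMost_Suc_shift) (simp add: sum.distrib)
  also have "\<dots> = q ^ (0 choose 2) * ipoly (qbinomial (Suc N) 0) q * z ^ 0
      + (\<Sum>k\<le>N. q ^ (Suc k choose 2) * ipoly (qbinomial (Suc N) (Suc k)) q * z ^ Suc k)"
    by (simp only: eq) (simp add: f_def)
  also have "\<dots> = (\<Sum>k\<le>Suc N. q ^ (k choose 2) * ipoly (qbinomial (Suc N) k) q * z ^ k)"
    by (rule sum.atMost_Suc_shift [symmetric])
  finally show ?case .
qed

section \<open>Fourier inversion on the unit circle\<close>

lemma integral_cis:
  "(\<integral>\<theta>. indicator {-pi..pi} \<theta> *\<^sub>R cis (of_int m * \<theta>) \<partial>lborel) = (if m = 0 then 2 * pi else 0)"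
proof (cases "m = 0")
  case True
  then show ?thesis by (simp add: scaleR_conv_of_real)
next
  case False
  define F where "F \<theta> = cis (of_int m * \<theta>) / (\<i> * of_int m)" for \<theta>
  have "((\<lambda>z. exp (\<i> * of_int m * z) / (\<i> * of_int m)) has_field_derivative
      exp (\<i> * of_int m * of_real \<theta>)) (at (of_real \<theta>))" for \<theta> :: real
    using False by (auto intro!: derivative_eq_intros)
  from has_vector_derivative_real_field[OF this]
  have "(F has_vector_derivative cis (of_int m * \<theta>)) (at \<theta> within {-pi..pi})" for \<theta>
    unfolding F_def cis_conv_exp by (simp add: mult.assoc)
  then have "(\<integral>\<theta>. indicator {-pi..pi} \<theta> *\<^sub>R cis (of_int m * \<theta>) \<partial>lborel) = F pi - F (-pi)"
    by (intro integral_FTC_atLeastAtMost continuous_intros) auto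
  also have "\<dots> = 0"
    unfolding F_def by (simp add: cis.ctr sin_int_times_real complex_eq_iff mult.commute[of _ pi])
  finally show ?thesis using False by simp
qed

text \<open>Orthogonality of the characters isolates one coefficient. With \<open>j\<close> an
  arbitrary integer, negative indices integrate to zero, in agreement with the default value in
  \<open>central_qcoeff\<close>.\<close>

lemma fourier_coefficient:
  fixes c :: "nat \<Rightarrow> complex" and j :: int
  shows "(\<integral>\<theta>. indicator {-pi..pi} \<theta> *\<^sub>R ((\<Sum>k\<le>N. c k * cis \<theta> ^ k) * cis (- (of_int j * \<theta>))) \<partial>lborel)
    = 2 * pi * (if 0 \<le> j \<and> j \<le> int N then c (nat j) else 0)"
proof -
  have "cis \<theta> ^ k * cis (- (of_int j * \<theta>)) = cis (of_int (int k - j) * \<theta>)" for k and \<theta> :: real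
    using cis_mult[of "real k * \<theta>" "- (of_int j * \<theta>)"] Complex.DeMoivre[of \<theta> k]
    by (simp add: left_diff_distrib)
  then have eq: "indicator {-pi..pi} \<theta> *\<^sub>R ((\<Sum>k\<le>N. c k * cis \<theta> ^ k) * cis (- (of_int j * \<theta>)))
      = (\<Sum>k\<le>N. c k * (indicator {-pi..pi} \<theta> *\<^sub>R cis (of_int (int k - j) * \<theta>)))" for \<theta>
    by (cases "\<theta> \<in> {-pi..pi}")
      (simp_all add: sum_distrib_right mult.assoc del: of_int_diff)
  have int: "integrable lborel (\<lambda>\<theta>. indicator {-pi..pi} \<theta> *\<^sub>R cis (of_int m * \<theta>))" for m
    by (intro borel_integrable_compact continuous_intros) auto
  have "(\<integral>\<theta>. indicator {-pi..pi} \<theta> *\<^sub>R ((\<Sum>k\<le>N. c k * cis \<theta> ^ k) * cis (- (of_int j * \<theta>))) \<partial>lborel)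
      = (\<Sum>k\<le>N. \<integral>\<theta>. c k * (indicator {-pi..pi} \<theta> *\<^sub>R cis (of_int (int k - j) * \<theta>)) \<partial>lborel)"
    unfolding eq using int by (intro Bochner_Integration.integral_sum integrable_mult_right)
  also have "\<dots> = (\<Sum>k\<le>N. c k * (if int k - j = 0 then 2 * pi else 0))"
    by (simp only: integral_mult_right_zero integral_cis)
  also have "\<dots> = (\<Sum>k\<le>N. if k = nat j \<and> 0 \<le> j then c k * (2 * pi) else 0)"
    by (intro sum.cong) auto
  also have "\<dots> = 2 * pi * (if 0 \<le> j \<and> j \<le> int N then c (nat j) else 0)"
    by (cases "0 \<le> j") (auto simp: sum.delta)
  finally show ?thesis .
qed

text \<open>A Cauchy estimate: by \<open>fourier_coefficient\<close>, a coefficient is an average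
  over the circle of the polynomial times a factor of modulus one.\<close>

lemma norm_coefficient_le:
  fixes c :: "nat \<Rightarrow> complex"
  assumes "\<And>\<theta>. norm (\<Sum>k\<le>N. c k * cis \<theta> ^ k) \<le> B" "j \<le> N"
  shows "norm (c j) \<le> B"
proof -
  let ?f = "\<lambda>\<theta>. indicator {-pi..pi} \<theta> *\<^sub>R ((\<Sum>k\<le>N. c k * cis \<theta> ^ k) * cis (- (of_int (int j) * \<theta>)))"
  have "2 * pi * norm (c j) = norm (\<integral>\<theta>. ?f \<theta> \<partial>lborel)"
    unfolding fourier_coefficient using assms(2) by (simp add: norm_mult)
  also have "\<dots> \<le> (\<integral>\<theta>. indicator {-pi..pi} \<theta> *\<^sub>R B \<partial>lborel)"
  proof (rule Bochner_Integration.integral_norm_bound_integral)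
    show "integrable lborel ?f"
      by (intro borel_integrable_compact continuous_intros) auto
    show "integrable lborel (\<lambda>\<theta>. indicator {-pi..pi} \<theta> *\<^sub>R B)"
      by (intro borel_integrable_compact continuous_intros) auto
  qed (use assms(1) in \<open>auto simp: indicator_def norm_mult\<close>)
  also have "\<dots> = 2 * pi * B" by simp
  finally show ?thesis by simp
qed

lemma central_qcoeff_integral:
  "(\<integral>\<theta>. indicator {-pi..pi} \<theta> *\<^sub>R (ipoly (qbinomial (2 * n) n) (cis \<theta>) * cis (- (of_int j * \<theta>))) \<partial>lborel)
    = 2 * pi * of_int (central_qcoeff n j)"
  unfolding ipoly_altdef fourier_coefficient
  by (auto simp: central_qcoeff_def coeff_eq_0)

section \<open>Gaussian bounds for quotients of sinc\<close>

text \<open>The difference \<open>u * cos u - sin u\<close> vanishes at \<open>0\<close> and has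
  derivative \<open>- u * sin u\<close>, which is nonpositive up to \<open>pi\<close>.\<close>

lemma mult_cos_le_sin:
  fixes u :: real
  assumes "0 \<le> u" "u \<le> pi"
  shows "u * cos u \<le> sin u"
proof -
  have "(\<lambda>u. u * cos u - sin u) u \<le> (\<lambda>u. u * cos u - sin u) 0"
  proof (rule DERIV_nonpos_imp_nonincreasing[OF assms(1)])
    fix x assume "0 \<le> x" "x \<le> u"
    then have "- (x * sin x) \<le> 0"
      using assms(2) sin_ge_zero[of x] by simp
    then show "\<exists>y. ((\<lambda>u. u * cos u - sin u) has_real_derivative y) (at x) \<and> y \<le> 0"
      by (intro exI[of _ "- (x * sin x)"]) (auto intro!: derivative_eq_intros)
  qed
  then show ?thesis by simp
qed

text \<open>Multiplication by \<open>u * sin u\<close> gives \<open>?K\<close>, which vanishes at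
  \<open>0\<close> and has derivative \<open>u / 3 * (u * cos u - sin u)\<close>, nonpositive by
  \<open>mult_cos_le_sin\<close>.\<close>

lemma sinc_log_derivative_nonpos:
  fixes u :: real
  assumes "0 < u" "u < pi"
  shows "cos u / sin u - 1 / u + u / 3 \<le> 0"
proof -
  let ?K = "\<lambda>u. u * cos u - sin u + u\<^sup>2 * sin u / 3 :: real"
  have "?K u \<le> ?K 0"
  proof (rule DERIV_nonpos_imp_nonincreasing[where f = ?K])
    fix x assume "0 \<le> x" "x \<le> u"
    then have "x / 3 * (x * cos x - sin x) \<le> 0"
      using assms(2) mult_cos_le_sin[of x] by (intro mult_nonneg_nonpos) auto
    then show "\<exists>y. (?K has_real_derivative y) (at x) \<and> y \<le> 0"
      by (intro exI[of _ "x / 3 * (x * cos x - sin x)"])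
        (auto intro!: derivative_eq_intros simp: power2_eq_square field_simps)
  qed (use assms in auto)
  moreover have "sin u > 0" using assms by (rule sin_gt_zero)
  moreover have "cos u / sin u - 1 / u + u / 3 = ?K u / (u * sin u)"
    using \<open>0 < u\<close> \<open>sin u > 0\<close> by (simp add: field_simps power2_eq_square)
  ultimately show ?thesis using assms by (simp add: divide_nonpos_pos)
qed

lemma sinc_gaussian_decreasing:
  fixes u v :: real
  assumes "0 < v" "v \<le> u" "u < pi"
  shows "ln (sin u / u) + u\<^sup>2 / 6 \<le> ln (sin v / v) + v\<^sup>2 / 6"
proof (rule DERIV_nonpos_imp_nonincreasing[OF \<open>v \<le> u\<close>])
  fix x assume "v \<le> x" "x \<le> u"
  then have x: "0 < x" "x < pi" using assms by auto
  then have "sin x > 0" by (intro sin_gt_zero)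
  with x have "((\<lambda>u. ln (sin u / u) + u\<^sup>2 / 6) has_real_derivative cos x / sin x - 1 / x + x / 3) (at x)"
    by (auto intro!: derivative_eq_intros simp: field_simps power2_eq_square)
  then show "\<exists>y. ((\<lambda>u. ln (sin u / u) + u\<^sup>2 / 6) has_real_derivative y) (at x) \<and> y \<le> 0"
    using sinc_log_derivative_nonpos[OF x] by blast
qed

text \<open>Integrated form of \<open>1 - x^2 / 2 \<le> cos x\<close>, which follows from writing
  \<open>cos x\<close> as one minus twice the square of \<open>sin (x / 2)\<close>.\<close>

lemma sin_ge_cubic:
  fixes u :: real
  assumes "0 \<le> u"
  shows "u - u ^ 3 / 6 \<le> sin u"
proof -
  have cos: "1 - x\<^sup>2 / 2 \<le> cos x" for x :: real
  proof -
    have "(sin (x / 2))\<^sup>2 \<le> (x / 2)\<^sup>2"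
      using abs_sin_x_le_abs_x[of "x / 2"] by (metis abs_le_square_iff)
    then show ?thesis
      using cos_double_sin[of "x / 2"] by (simp add: power2_eq_square)
  qed
  have "(\<lambda>u. sin u - u + u ^ 3 / 6) 0 \<le> (\<lambda>u. sin u - u + u ^ 3 / 6) u"
  proof (rule DERIV_nonneg_imp_nondecreasing[OF assms])
    fix x :: real
    show "\<exists>y. ((\<lambda>u. sin u - u + u ^ 3 / 6) has_real_derivative y) (at x) \<and> 0 \<le> y"
      using cos[of x] by (intro exI[of _ "cos x - 1 + x\<^sup>2 / 2"])
        (auto intro!: derivative_eq_intros simp: power2_eq_square)
  qed
  then show ?thesis by simp
qed

lemma sinc_gaussian_lower:
  fixes u :: real
  assumes "0 < u" "u \<le> 1"
  shows "- (u ^ 4 / 18) \<le> ln (sin u / u) + u\<^sup>2 / 6"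
proof -
  have u: "u\<^sup>2 \<le> 1" using assms by (simp add: power_le_one)
  have "1 - u\<^sup>2 / 6 \<le> sin u / u"
    using sin_ge_cubic[of u] assms by (simp add: field_simps power2_eq_square power3_eq_cube)
  then have "ln (1 - u\<^sup>2 / 6) \<le> ln (sin u / u)"
    using u by (subst ln_le_cancel_iff) auto
  \<comment> \<open>With \<open>y = u^2 / 6\<close> this is
    \<open>- y - 2 * y^2 \<le> ln (1 - y)\<close>, and \<open>2 * y^2 = u^4 / 18\<close> is the
    error term.\<close>
  moreover have "- (u\<^sup>2 / 6) - 2 * (u\<^sup>2 / 6)\<^sup>2 \<le> ln (1 - u\<^sup>2 / 6)"
    using u by (intro ln_one_minus_pos_lower_bound) auto
  ultimately show ?thesis by (simp add: power_divide flip: power_mult)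
qed

lemma sinc_quotient_le:
  fixes u v :: real
  assumes "0 < v" "v \<le> u" "u < pi"
  shows "(sin u / u) / (sin v / v) \<le> exp (- ((u\<^sup>2 - v\<^sup>2) / 6))"
proof -
  have "sin u / u > 0" "sin v / v > 0"
    using assms by (auto intro!: divide_pos_pos sin_gt_zero)
  then have "(sin u / u) / (sin v / v) = exp (ln (sin u / u) - ln (sin v / v))"
    by (simp only: exp_diff exp_ln)
  also have "\<dots> \<le> exp (- ((u\<^sup>2 - v\<^sup>2) / 6))"
    using sinc_gaussian_decreasing[OF assms] by (simp add: diff_divide_distrib)
  finally show ?thesis .
qed

text \<open>Only the numerator contributes an error, through \<open>sinc_gaussian_lower\<close>; for
  the denominator an exact Gaussian upper bound suffices.\<close>

lemma sinc_quotient_ge: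
  fixes u v :: real
  assumes "0 < v" "v \<le> u" "u \<le> 1"
  shows "exp (- ((u\<^sup>2 - v\<^sup>2) / 6) - u ^ 4 / 18) \<le> (sin u / u) / (sin v / v)"
proof -
  have pi: "u < pi" "v < pi" using assms pi_gt3 by auto
  have pos: "sin u > 0" "sin v > 0"
    using assms pi by (auto intro!: sin_gt_zero)
  then have pos': "sin u / u > 0" "sin v / v > 0"
    using assms by auto
  \<comment> \<open>By monotonicity the value at \<open>v\<close> is at most the right-hand limit at
    zero, which is \<open>0\<close>.\<close>
  have "ln (sin v / v) + v\<^sup>2 / 6 \<le> 0"
  proof (rule tendsto_lowerbound)
    show "((\<lambda>x::real. ln (sin x / x) + x\<^sup>2 / 6) \<longlongrightarrow> 0) (at_right 0)"
      by real_asymp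
    show "\<forall>\<^sub>F x in at_right 0. ln (sin v / v) + v\<^sup>2 / 6 \<le> ln (sin x / x) + x\<^sup>2 / 6"
      by (intro eventually_at_rightI[of 0 v]) (use assms pi in \<open>auto intro!: sinc_gaussian_decreasing\<close>)
  qed simp
  then have "- ((u\<^sup>2 - v\<^sup>2) / 6) - u ^ 4 / 18 \<le> ln (sin u / u) - ln (sin v / v)"
    using sinc_gaussian_lower[of u] assms by (simp add: diff_divide_distrib)
  moreover have "(sin u / u) / (sin v / v) = exp (ln (sin u / u) - ln (sin v / v))"
    using pos' by (simp only: exp_diff exp_ln)
  ultimately show ?thesis by simp
qed

section \<open>The characteristic function\<close>

lemma AM_GM_power:
  fixes x :: "nat \<Rightarrow> real" and b :: real
  assumes "m > 0" "\<And>i. i < m \<Longrightarrow> x i \<ge> 0" "(\<Sum>i<m. x i) \<le> m * b"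
  shows "(\<Prod>i<m. x i) \<le> b ^ m"
proof -
  have nonneg: "0 \<le> (\<Prod>i<m. x i)" using assms(2) by (intro prod_nonneg) auto
  have "(\<Prod>i<m. x i) powr (1 / m) \<le> (\<Sum>i<m. x i) / m"
    using arith_geom_mean[of "{..<m}" x] assms(1,2) by (auto simp: sum_divide_distrib lessThan_empty_iff)
  also have "\<dots> \<le> b"
    using assms(1,3) by (simp add: divide_le_eq mult.commute)
  finally have "((\<Prod>i<m. x i) powr (1 / m)) ^ m \<le> b ^ m"
    by (intro power_mono) auto
  moreover have "(p powr (1 / m)) ^ m = p" if "0 \<le> p" for p :: real
    using that assms(1) by (cases "p = 0") (simp_all add: powr_power)
  ultimately show ?thesis using nonneg by simp
qed

lemma one_minus_cis: "1 - cis x = - (2 * \<i> * sin (x / 2)) * cis (x / 2)"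
  using cos_double_sin[of "x / 2"] sin_double[of "x / 2"]
  by (simp add: complex_eq_iff power2_eq_square)

text \<open>For positive \<open>x\<close> up to \<open>pi / 2\<close> the quotient
  \<open>sin x / x\<close> decreases, and its value at \<open>pi / 2\<close> is
  \<open>2 / pi\<close>.\<close>

lemma jordan_sin:
  fixes x :: real
  assumes "0 \<le> x" "x \<le> pi / 2"
  shows "2 * x / pi \<le> sin x"
proof (cases "x = 0")
  case False
  then have "0 < x" using assms by simp
  have "(\<lambda>x. sin x / x) (pi / 2) \<le> (\<lambda>x. sin x / x) x"
  proof (rule DERIV_nonpos_imp_nonincreasing[OF assms(2)])
    fix y assume "x \<le> y" "y \<le> pi / 2"
    then have y: "0 < y" "y \<le> pi" using \<open>0 < x\<close> pi_gt_zero by linarith+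
    then have "((\<lambda>x. sin x / x) has_real_derivative (y * cos y - sin y) / y\<^sup>2) (at y)"
      by (auto intro!: derivative_eq_intros simp: power2_eq_square field_simps)
    moreover have "(y * cos y - sin y) / y\<^sup>2 \<le> 0"
      using y mult_cos_le_sin[of y] by (intro divide_nonpos_nonneg) auto
    ultimately show "\<exists>d. ((\<lambda>x. sin x / x) has_real_derivative d) (at y) \<and> d \<le> 0" by blast
  qed
  then show ?thesis using \<open>0 < x\<close> by (simp add: field_simps)
qed simp

lemma norm_one_minus_cis_ge:
  assumes "\<bar>\<theta>\<bar> \<le> pi"
  shows "2 * \<bar>\<theta>\<bar> / pi \<le> norm (1 - cis \<theta>)"
proof -
  have "2 * (\<bar>\<theta>\<bar> / 2) / pi \<le> sin (\<bar>\<theta>\<bar> / 2)"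
    using assms by (intro jordan_sin) auto
  also have "\<dots> \<le> \<bar>sin (\<theta> / 2)\<bar>"
    by (cases "\<theta> \<ge> 0") auto
  finally show ?thesis by (simp add: one_minus_cis norm_mult)
qed

text \<open>On the circle \<open>\<bar>z\<bar> = 1\<close> the factors \<open>\<bar>1 + z q\<^sup>i\<bar>\<^sup>2 = 2 + 2 Re (z q\<^sup>i)\<close> have mean at most \<open>3\<close>,
  because the geometric sum of the \<open>q\<^sup>i\<close> is at most \<open>n\<close> in absolute value.\<close>

lemma norm_qbinomial_tail:
  assumes "n > 0" "pi / n \<le> \<bar>\<theta>\<bar>" "\<bar>\<theta>\<bar> \<le> pi"
  shows "norm (ipoly (qbinomial (2 * n) n) (cis \<theta>)) \<le> 3 ^ n"
proof -
  define q where "q = cis \<theta>"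
  have "2 / n \<le> 2 * \<bar>\<theta>\<bar> / pi"
    using assms by (simp add: field_simps)
  also have "\<dots> \<le> norm (1 - q)"
    unfolding q_def by (rule norm_one_minus_cis_ge[OF assms(3)])
  finally have q: "2 / n \<le> norm (1 - q)" .
  with assms(1) have "q \<noteq> 1" by (auto simp: divide_le_0_iff)
  \<comment> \<open>The numerator of the summed geometric series has modulus at most
    \<open>2\<close>, the denominator at least \<open>2 / n\<close>.\<close>
  have "norm (\<Sum>i<2 * n. q ^ i) = norm (1 - q ^ (2 * n)) / norm (1 - q)"
    using \<open>q \<noteq> 1\<close> by (simp add: sum_gp_strict norm_divide)
  also have "\<dots> \<le> 2 / (2 / n)"
    using q norm_triangle_ineq4[of 1 "q ^ (2 * n)"] assms(1)
    by (intro frac_le) (auto simp: q_def norm_power)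
  finally have geo: "norm (\<Sum>i<2 * n. q ^ i) \<le> n" by simp
  \<comment> \<open>Here \<open>cis \<psi>\<close> plays the role of \<open>z\<close>: a bound on
    the product uniform in \<open>\<psi>\<close> transfers to each of its coefficients.\<close>
  have "norm (\<Sum>k\<le>2 * n. (q ^ (k choose 2) * ipoly (qbinomial (2 * n) k) q) * cis \<psi> ^ k) \<le> 3 ^ n" for \<psi>
  proof -
    have sq: "(norm (1 + cis \<psi> * q ^ i))\<^sup>2 = 2 + 2 * Re (cis \<psi> * q ^ i)" for i
    proof -
      have "norm (cis \<psi> * q ^ i) = 1" by (simp add: q_def norm_mult norm_power)
      then have "(Re (cis \<psi> * q ^ i))\<^sup>2 + (Im (cis \<psi> * q ^ i))\<^sup>2 = 1"
        by (metis cmod_power2 one_power2)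
      then show ?thesis
        unfolding cmod_power2 by (simp add: power2_sum)
    qed
    have "(\<Sum>i<2 * n. (norm (1 + cis \<psi> * q ^ i))\<^sup>2) = 4 * n + 2 * Re (cis \<psi> * (\<Sum>i<2 * n. q ^ i))"
      by (simp only: sq sum.distrib Re_sum sum_distrib_left) simp
    also have "Re (cis \<psi> * (\<Sum>i<2 * n. q ^ i)) \<le> n"
      using complex_Re_le_cmod[of "cis \<psi> * (\<Sum>i<2 * n. q ^ i)"] geo by (simp only: norm_mult norm_cis)
    finally have "(\<Prod>i<2 * n. (norm (1 + cis \<psi> * q ^ i))\<^sup>2) \<le> 3 ^ (2 * n)"
      using assms(1) by (intro AM_GM_power) auto
    moreover have "(norm (\<Prod>i<2 * n. 1 + cis \<psi> * q ^ i))\<^sup>2 = (\<Prod>i<2 * n. (norm (1 + cis \<psi> * q ^ i))\<^sup>2)"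
      by (simp only: prod_norm[symmetric] prod_power_distrib)
    moreover have "(3::real) ^ (2 * n) = (3 ^ n)\<^sup>2"
      by (metis power_mult mult.commute)
    ultimately have "(norm (\<Prod>i<2 * n. 1 + cis \<psi> * q ^ i))\<^sup>2 \<le> (3 ^ n)\<^sup>2"
      by (simp only:)
    then show ?thesis
      unfolding q_binomial_theorem by (rule power2_le_imp_le) simp
  qed
  \<comment> \<open>The coefficient with \<open>k = n\<close> is the central one; its extra power of
    \<open>q\<close> has modulus one.\<close>
  then have "norm (q ^ (n choose 2) * ipoly (qbinomial (2 * n) n) q) \<le> 3 ^ n"
    by (rule norm_coefficient_le) simp
  then show ?thesis by (simp add: q_def norm_mult norm_power)
qed

text \<open>The characteristic function of the centred number of inversions.\<close>

definition inv_char :: "nat \<Rightarrow> real \<Rightarrow> complex" where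
  "inv_char n \<theta> = ipoly (qbinomial (2 * n) n) (cis \<theta>) * cis (- (inv_mean n * \<theta>)) / of_nat ((2 * n) choose n)"

text \<open>The normalising binomial coefficient is at least \<open>4 ^ n / (2 * real n)\<close>,
  which outgrows \<open>3 ^ n\<close>.\<close>

lemma norm_inv_char_tail:
  assumes "n > 0" "pi / n \<le> \<bar>\<theta>\<bar>" "\<bar>\<theta>\<bar> \<le> pi"
  shows "norm (inv_char n \<theta>) \<le> 2 * real n * (3 / 4) ^ n"
proof -
  have "norm (inv_char n \<theta>) \<le> 3 ^ n / (4 ^ n / (2 * real n))"
    unfolding inv_char_def norm_mult norm_divide norm_cis norm_of_nat mult_1_right
    using assms central_binomial_lower_bound[of n] by (intro frac_le norm_qbinomial_tail) auto
  then show ?thesis by (simp add: power_divide mult.commute)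
qed

section \<open>Product formula and Gaussian bounds near the origin\<close>

text \<open>Each factor \<open>(1 - q^(2n-i)) / (1 - q^(n-i))\<close> is a quotient of sines times
  the phase \<open>cis (n * \<theta> / 2)\<close>. The \<open>n\<close> phases multiply to the phase
  of the mean, which the centring removes. Dividing by the factors \<open>(2n-i) / (n-i)\<close> of
  the binomial coefficient turns the sines into values of \<open>sin x / x\<close>.\<close>

lemma inv_char_product:
  assumes "\<theta> \<noteq> 0" "n * \<bar>\<theta>\<bar> < 2 * pi"
  shows "inv_char n \<theta> = of_real (\<Prod>i<n. (sin (real (2 * n - i) * \<bar>\<theta>\<bar> / 2) / (real (2 * n - i) * \<bar>\<theta>\<bar> / 2))
    / (sin (real (n - i) * \<bar>\<theta>\<bar> / 2) / (real (n - i) * \<bar>\<theta>\<bar> / 2)))"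
proof -
  define u v where "u i = real (2 * n - i) * \<theta> / 2" and "v i = real (n - i) * \<theta> / 2" for i
  have pow: "cis \<theta> ^ k = cis (real k * \<theta>)" for k by (rule Complex.DeMoivre)
  \<comment> \<open>Since \<open>n * \<bar>\<theta>\<bar> < 2 * pi\<close>, the absolute value of
    \<open>v i\<close> lies strictly between \<open>0\<close> and \<open>pi\<close>.\<close>
  have sinv: "sin (v i) \<noteq> 0" if "i < n" for i
  proof -
    have pos: "0 < real (n - i) * \<bar>\<theta>\<bar> / 2" using that assms(1) by simp
    have "real (n - i) * \<bar>\<theta>\<bar> \<le> n * \<bar>\<theta>\<bar>" by (intro mult_right_mono) auto
    then have "real (n - i) * \<bar>\<theta>\<bar> / 2 < pi" using assms(2) by simp
    then have "sin (real (n - i) * \<bar>\<theta>\<bar> / 2) > 0" using pos by (intro sin_gt_zero)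
    then show ?thesis by (cases "\<theta> > 0") (auto simp: v_def)
  qed
  have "ipoly (qbinomial (2 * n) n) (cis \<theta>) * (\<Prod>i<n. 1 - cis \<theta> ^ (n - i)) = (\<Prod>i<n. 1 - cis \<theta> ^ (2 * n - i))"
    using arg_cong[OF qbinomial_times_denominator[of "2 * n" n], of "\<lambda>p. ipoly p (cis \<theta>)"] by simp
  moreover have "1 - cis \<theta> ^ (n - i) \<noteq> 0" if "i < n" for i
    using sinv[OF that] by (simp add: pow one_minus_cis v_def)
  ultimately have "ipoly (qbinomial (2 * n) n) (cis \<theta>) = (\<Prod>i<n. (1 - cis \<theta> ^ (2 * n - i)) / (1 - cis \<theta> ^ (n - i)))"
    by (simp add: prod_dividef field_simps)
  also have "\<dots> = (\<Prod>i<n. of_real (sin (u i) / sin (v i)) * cis (n * \<theta> / 2))"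
  proof (rule prod.cong)
    fix i assume "i \<in> {..<n}"
    then have "i < n" by simp
    then have "cis (u i) = cis (n * \<theta> / 2) * cis (v i)"
      by (simp add: u_def v_def cis_mult of_nat_diff field_simps)
    then show "(1 - cis \<theta> ^ (2 * n - i)) / (1 - cis \<theta> ^ (n - i)) = of_real (sin (u i) / sin (v i)) * cis (n * \<theta> / 2)"
      using sinv[OF \<open>i < n\<close>] by (simp add: pow one_minus_cis u_def[symmetric] v_def[symmetric])
  qed simp
  also have "\<dots> = of_real (\<Prod>i<n. sin (u i) / sin (v i)) * cis (inv_mean n * \<theta>)"
  proof -
    have "cis (n * \<theta> / 2) ^ n = cis (inv_mean n * \<theta>)"
      unfolding Complex.DeMoivre by (simp add: inv_mean_def power2_eq_square mult.assoc)
    then show ?thesis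
      by (simp only: prod.distrib prod_constant card_lessThan of_real_prod)
  qed
  finally have "inv_char n \<theta> = of_real (\<Prod>i<n. sin (u i) / sin (v i)) / of_nat ((2 * n) choose n)"
    by (simp add: inv_char_def mult.assoc cis_mult)
  also have "(of_nat ((2 * n) choose n) :: complex) = of_real (\<Prod>i<n. real (2 * n - i) / real (n - i))"
    unfolding of_real_of_nat_eq[symmetric, where 'a = complex]
    using binomial_altdef_of_nat[of n "2 * n", where 'a = real] by (simp add: atLeast0LessThan)
  also have "of_real (\<Prod>i<n. sin (u i) / sin (v i)) / \<dots>
      = of_real (\<Prod>i<n. (sin (u i) / sin (v i)) / (real (2 * n - i) / real (n - i)))"
    by (simp only: of_real_divide[symmetric] prod_dividef)
  also have "(\<Prod>i<n. (sin (u i) / sin (v i)) / (real (2 * n - i) / real (n - i)))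
      = (\<Prod>i<n. (sin (real (2 * n - i) * \<bar>\<theta>\<bar> / 2) / (real (2 * n - i) * \<bar>\<theta>\<bar> / 2))
    / (sin (real (n - i) * \<bar>\<theta>\<bar> / 2) / (real (n - i) * \<bar>\<theta>\<bar> / 2)))"
  proof (rule prod.cong)
    fix i
    \<comment> \<open>Evenness of \<open>sin x / x\<close> allows passing to
      \<open>\<bar>\<theta>\<bar>\<close>; the sinc estimates are stated for positive
      arguments.\<close>
    have even: "sin (c * \<bar>\<theta>\<bar> / 2) / (c * \<bar>\<theta>\<bar> / 2) = sin (c * \<theta> / 2) / (c * \<theta> / 2)" for c :: real
      by (cases "\<theta> \<ge> 0") simp_all
    have "x / y / (a / b) = x / (a * \<theta> / 2) / (y / (b * \<theta> / 2))" for x y a b :: real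
      using assms(1) by simp
    then show "(sin (u i) / sin (v i)) / (real (2 * n - i) / real (n - i))
      = (sin (real (2 * n - i) * \<bar>\<theta>\<bar> / 2) / (real (2 * n - i) * \<bar>\<theta>\<bar> / 2))
        / (sin (real (n - i) * \<bar>\<theta>\<bar> / 2) / (real (n - i) * \<bar>\<theta>\<bar> / 2))"
      unfolding even u_def v_def .
  qed simp
  finally show ?thesis .
qed

text \<open>The exponents of \<open>sinc_quotient_le\<close> over all factors of the product formula
  add up to exactly this, so the Gaussian bound carries the true variance. Each summand is affine in
  \<open>i\<close>.\<close>

lemma inv_variance_sum:
  "(\<Sum>i<n. ((real (2 * n - i) * t / 2)\<^sup>2 - (real (n - i) * t / 2)\<^sup>2) / 6) = inv_variance n * t\<^sup>2 / 2"
proof -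
  have sq: "(((2 * N - I) * t / 2)\<^sup>2 - ((N - I) * t / 2)\<^sup>2) / 6 = t\<^sup>2 * N\<^sup>2 / 8 - t\<^sup>2 * N / 12 * I" for N I :: real
    by (simp add: power2_eq_square field_simps)
  have "(\<Sum>i<n. ((real (2 * n - i) * t / 2)\<^sup>2 - (real (n - i) * t / 2)\<^sup>2) / 6)
      = (\<Sum>i<n. t\<^sup>2 * (real n)\<^sup>2 / 8 - t\<^sup>2 * real n / 12 * real i)"
    using sq[of "real n"] by (intro sum.cong) (simp_all add: of_nat_diff)
  also have "\<dots> = n * (t\<^sup>2 * (real n)\<^sup>2 / 8) - t\<^sup>2 * real n / 12 * (\<Sum>i<n. real i)"
    by (simp only: sum_subtractf sum_distrib_left[symmetric] sum_constant card_lessThan)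
  also have "(\<Sum>i<n. real i) = real n * (real n - 1) / 2"
    by (induction n) (auto simp: field_simps)
  also have "n * (t\<^sup>2 * (real n)\<^sup>2 / 8) - t\<^sup>2 * real n / 12 * (real n * (real n - 1) / 2) = inv_variance n * t\<^sup>2 / 2"
    by (simp add: inv_variance_def power2_eq_square field_simps)
  finally show ?thesis .
qed

text \<open>All sine arguments are positive and at most \<open>n * \<bar>\<theta>\<bar>\<close>, so
  every factor of \<open>inv_char_product\<close> obeys the sinc estimates. The lower bound loses
  \<open>u^4 / 18\<close> per factor, each at most
  \<open>(n * \<bar>\<theta>\<bar>) ^ 4 / 18\<close>.\<close>

lemma inv_char_central:
  assumes "\<theta> \<noteq> 0" "n * \<bar>\<theta>\<bar> < pi"
  obtains r where "inv_char n \<theta> = of_real r" "0 \<le> r" "r \<le> exp (- (inv_variance n * \<theta>\<^sup>2 / 2))"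
    "n * \<bar>\<theta>\<bar> \<le> 1 \<Longrightarrow> exp (- (inv_variance n * \<theta>\<^sup>2 / 2) - n * (n * \<bar>\<theta>\<bar>) ^ 4 / 18) \<le> r"
proof -
  define u v where "u i = real (2 * n - i) * \<bar>\<theta>\<bar> / 2" and "v i = real (n - i) * \<bar>\<theta>\<bar> / 2" for i
  define f where "f i = (sin (u i) / u i) / (sin (v i) / v i)" for i
  have v: "0 < v i" "v i \<le> u i" "u i \<le> n * \<bar>\<theta>\<bar>" if "i < n" for i
  proof -
    show "0 < v i" using that assms(1) by (simp add: v_def)
    show "v i \<le> u i" unfolding u_def v_def by (intro divide_right_mono mult_right_mono) auto
    have "real (2 * n - i) * \<bar>\<theta>\<bar> \<le> real (2 * n) * \<bar>\<theta>\<bar>" by (intro mult_right_mono) auto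
    then show "u i \<le> n * \<bar>\<theta>\<bar>" by (simp add: u_def)
  qed
  have f: "0 \<le> f i" "f i \<le> exp (- (((u i)\<^sup>2 - (v i)\<^sup>2) / 6))" if "i < n" for i
  proof -
    have "u i < pi" "v i < pi" "0 < v i" "0 < u i" using v[OF that] assms(2) by linarith+
    then show "0 \<le> f i" unfolding f_def by (intro divide_nonneg_nonneg sin_ge_zero) auto
    show "f i \<le> exp (- (((u i)\<^sup>2 - (v i)\<^sup>2) / 6))"
      unfolding f_def using v[OF that] \<open>u i < pi\<close> by (intro sinc_quotient_le)
  qed
  have var: "(\<Sum>i<n. ((u i)\<^sup>2 - (v i)\<^sup>2) / 6) = inv_variance n * \<theta>\<^sup>2 / 2"
    unfolding u_def v_def inv_variance_sum by simp
  show thesis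
  proof
    show "inv_char n \<theta> = of_real (\<Prod>i<n. f i)"
      unfolding f_def u_def v_def using assms pi_gt_zero by (intro inv_char_product) linarith+
    show "0 \<le> (\<Prod>i<n. f i)" using f by (intro prod_nonneg) auto
    have "(\<Prod>i<n. f i) \<le> (\<Prod>i<n. exp (- (((u i)\<^sup>2 - (v i)\<^sup>2) / 6)))"
      using f by (intro prod_mono) auto
    also have "\<dots> = exp (- (inv_variance n * \<theta>\<^sup>2 / 2))"
      by (simp add: sum_negf var flip: exp_sum)
    finally show "(\<Prod>i<n. f i) \<le> exp (- (inv_variance n * \<theta>\<^sup>2 / 2))" .
    assume small: "n * \<bar>\<theta>\<bar> \<le> 1"
    have "(u i) ^ 4 \<le> (n * \<bar>\<theta>\<bar>) ^ 4" if "i < n" for i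
      using v[OF that] by (intro power_mono) auto
    then have "(\<Sum>i<n. (u i) ^ 4 / 18) \<le> (\<Sum>i<n. (n * \<bar>\<theta>\<bar>) ^ 4 / 18)"
      by (intro sum_mono) auto
    then have "- (inv_variance n * \<theta>\<^sup>2 / 2) - n * (n * \<bar>\<theta>\<bar>) ^ 4 / 18
        \<le> (\<Sum>i<n. - (((u i)\<^sup>2 - (v i)\<^sup>2) / 6) - (u i) ^ 4 / 18)"
      by (simp add: sum_subtractf sum_negf var)
    then have "exp (- (inv_variance n * \<theta>\<^sup>2 / 2) - n * (n * \<bar>\<theta>\<bar>) ^ 4 / 18)
        \<le> (\<Prod>i<n. exp (- (((u i)\<^sup>2 - (v i)\<^sup>2) / 6) - (u i) ^ 4 / 18))"
      by (simp flip: exp_sum)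
    also have "\<dots> \<le> (\<Prod>i<n. f i)"
    proof (rule prod_mono)
      fix i assume "i \<in> {..<n}"
      then have "i < n" by simp
      from v[OF this] small show "0 \<le> exp (- (((u i)\<^sup>2 - (v i)\<^sup>2) / 6) - (u i) ^ 4 / 18)
          \<and> exp (- (((u i)\<^sup>2 - (v i)\<^sup>2) / 6) - (u i) ^ 4 / 18) \<le> f i"
        unfolding f_def by (intro conjI sinc_quotient_ge) auto
    qed
    finally show "exp (- (inv_variance n * \<theta>\<^sup>2 / 2) - n * (n * \<bar>\<theta>\<bar>) ^ 4 / 18) \<le> (\<Prod>i<n. f i)" .
  qed
qed

section \<open>Log-concavity from weighted closeness to the Gaussian\<close>

lemma exp_gaussian_conv: "exp (- (t\<^sup>2 / 2)) = sqrt (2 * pi) * std_normal_density t"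
  by (simp add: normal_density_def)

lemma integrable_gaussian_weight: "integrable lborel (\<lambda>t::real. (1 + t\<^sup>2) * exp (- (t\<^sup>2 / 2)))"
proof -
  have "integrable lborel (\<lambda>t. sqrt (2 * pi) * (std_normal_density t * t ^ 0)
      + sqrt (2 * pi) * (std_normal_density t * t ^ 2))"
    by (intro Bochner_Integration.integrable_add integrable_mult_right integrable_std_normal_moment)
  then show ?thesis
    by (rule Bochner_Integration.integrable_cong[THEN iffD1, rotated -1])
      (simp_all only: exp_gaussian_conv, simp_all add: algebra_simps)
qed

text \<open>A rescaling of the characteristic function of the standard normal distribution, taken at
  \<open>- x\<close>.\<close>

lemma gaussian_fourier:
  "(\<integral>t. of_real (exp (- (t\<^sup>2 / 2))) * cis (- (x * t)) \<partial>lborel) = of_real (sqrt (2 * pi) * exp (- (x\<^sup>2 / 2)))"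
proof -
  have "of_real (exp (- (x\<^sup>2 / 2))) = char std_normal_distribution (- x)"
    by (simp add: char_std_normal_distribution)
  also have "\<dots> = (\<integral>t. std_normal_density t *\<^sub>R cis (- (x * t)) \<partial>lborel)"
    unfolding char_def by (subst integral_density) (simp_all add: cis_conv_exp mult.commute)
  finally have "of_real (sqrt (2 * pi) * exp (- (x\<^sup>2 / 2)))
      = of_real (sqrt (2 * pi)) * (\<integral>t. std_normal_density t *\<^sub>R cis (- (x * t)) \<partial>lborel)"
    by simp
  also have "\<dots> = (\<integral>t. of_real (sqrt (2 * pi)) * (std_normal_density t *\<^sub>R cis (- (x * t))) \<partial>lborel)"
    by (rule integral_mult_right_zero [symmetric])
  also have "\<dots> = (\<integral>t. of_real (exp (- (t\<^sup>2 / 2))) * cis (- (x * t)) \<partial>lborel)"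
    by (simp only: exp_gaussian_conv) (simp add: scaleR_conv_of_real mult.assoc)
  finally show ?thesis ..
qed

text \<open>The modulus is \<open>\<bar>sin (h * t)\<bar> / h\<close>, hence at most
  \<open>\<bar>t\<bar>\<close>. The bound involves neither \<open>x\<close> nor \<open>h\<close>, so
  one weight controls the quotient as the step shrinks.\<close>

lemma norm_cis_central_difference:
  fixes h x t :: real
  assumes "h > 0"
  shows "norm ((cis (- ((x + h) * t)) - cis (- ((x - h) * t))) / (2 * h)) \<le> 1 + t\<^sup>2"
proof -
  have "cis (- ((x + h) * t)) - cis (- ((x - h) * t)) = cis (- (x * t)) * (cis (- (h * t)) - cis (h * t))"
    by (simp add: right_diff_distrib cis_mult algebra_simps)
  also have "cis (- (h * t)) - cis (h * t) = - (2 * \<i> * sin (h * t))"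
    by (simp add: complex_eq_iff)
  finally have "norm ((cis (- ((x + h) * t)) - cis (- ((x - h) * t))) / (2 * h)) = \<bar>sin (h * t)\<bar> / h"
    using assms by (simp add: norm_mult norm_divide)
  also have "\<dots> \<le> \<bar>t\<bar>"
    using abs_sin_x_le_abs_x[of "h * t"] assms by (simp add: divide_le_eq abs_mult mult.commute)
  also have "\<bar>t\<bar> \<le> 1 + t\<^sup>2"
    using zero_le_power2[of "\<bar>t\<bar> - 1"] by (simp add: power2_diff)
  finally show ?thesis .
qed

text \<open>The modulus is \<open>4 / h^2\<close> times the square of
  \<open>sin (h * t / 2)\<close>, hence at most \<open>t^2\<close>. This kernel dictates the
  quadratic weight.\<close>

lemma norm_cis_second_difference:
  fixes h x t :: real
  assumes "h > 0"
  shows "norm ((2 * cis (- (x * t)) - cis (- ((x + h) * t)) - cis (- ((x - h) * t))) / h\<^sup>2) \<le> 1 + t\<^sup>2"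
proof -
  have "2 * cis (- (x * t)) - cis (- ((x + h) * t)) - cis (- ((x - h) * t))
      = cis (- (x * t)) * (2 - (cis (- (h * t)) + cis (h * t)))"
    by (simp add: right_diff_distrib distrib_left cis_mult algebra_simps)
  also have "2 - (cis (- (h * t)) + cis (h * t)) = of_real (4 * (sin (h * t / 2))\<^sup>2)"
    using cos_double_sin[of "h * t / 2"] by (simp add: complex_eq_iff)
  finally have "norm ((2 * cis (- (x * t)) - cis (- ((x + h) * t)) - cis (- ((x - h) * t))) / h\<^sup>2)
      = 4 * (sin (h * t / 2))\<^sup>2 / h\<^sup>2"
    using assms by (simp add: norm_mult norm_divide norm_power del: of_real_mult of_real_power)
  also have "\<dots> \<le> 4 * (h * t / 2)\<^sup>2 / h\<^sup>2"
    using abs_sin_x_le_abs_x[of "h * t / 2"]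
    by (intro divide_right_mono mult_left_mono) (simp_all only: abs_le_square_iff, simp_all)
  also have "\<dots> \<le> 1 + t\<^sup>2"
    using assms by (simp add: power_mult_distrib power_divide)
  finally show ?thesis .
qed

text \<open>The differences enter divided by \<open>h\<close> and \<open>h\<^sup>2\<close>, so that errors of size \<open>\<epsilon>\<close> in them
  survive multiplication by \<open>h\<^sup>2\<close>.\<close>

lemma log_concavity_gap:
  fixes a p m h :: real
  assumes "h > 0"
  defines "s \<equiv> (2 * a - p - m) / h\<^sup>2" and "d \<equiv> (p - m) / (2 * h)"
  shows "a\<^sup>2 - p * m = h\<^sup>2 * (a * s + d\<^sup>2 - h\<^sup>2 * s\<^sup>2 / 4)"
proof -
  have "h\<^sup>2 * s = 2 * a - p - m" "h * d = (p - m) / 2"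
    using assms(1) by (simp_all add: s_def d_def)
  moreover have "h\<^sup>2 * (a * s + d\<^sup>2 - h\<^sup>2 * s\<^sup>2 / 4) = a * (h\<^sup>2 * s) + (h * d)\<^sup>2 - (h\<^sup>2 * s)\<^sup>2 / 4"
    by (simp add: power2_eq_square algebra_simps)
  ultimately have "h\<^sup>2 * (a * s + d\<^sup>2 - h\<^sup>2 * s\<^sup>2 / 4) = a * (2 * a - p - m) + ((p - m) / 2)\<^sup>2 - (2 * a - p - m)\<^sup>2 / 4"
    by (simp only:)
  also have "\<dots> = a\<^sup>2 - p * m"
    by (simp add: power2_eq_square field_simps)
  finally show ?thesis ..
qed

text \<open>The constant collects three products \<open>a * s\<close>, \<open>d * d\<close> and
  \<open>s * s\<close>, each of which moves by at most \<open>(2 * B + 1) * e\<close>; the last one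
  carries a factor \<open>h^2 / 4 \<le> 1\<close>.\<close>

lemma log_concavity_gap_perturbation:
  fixes a s d a' s' d' h B e :: real
  assumes "\<bar>a - a'\<bar> \<le> e" "\<bar>s - s'\<bar> \<le> e" "\<bar>d - d'\<bar> \<le> e"
    and "\<bar>a'\<bar> \<le> B" "\<bar>s'\<bar> \<le> B" "\<bar>d'\<bar> \<le> B" "e \<le> 1" "0 \<le> h" "h \<le> 1"
  shows "a' * s' + d'\<^sup>2 - h\<^sup>2 * s'\<^sup>2 / 4 - (6 * B + 3) * e \<le> a * s + d\<^sup>2 - h\<^sup>2 * s\<^sup>2 / 4"
proof -
  have e: "0 \<le> e" and B: "0 \<le> B" using assms by linarith+
  have prod: "\<bar>y * z - y' * z'\<bar> \<le> (2 * B + 1) * e"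
    if "\<bar>y - y'\<bar> \<le> e" "\<bar>z - z'\<bar> \<le> e" "\<bar>y'\<bar> \<le> B" "\<bar>z'\<bar> \<le> B" for y z y' z' :: real
  proof -
    have "y * z - y' * z' = (y - y') * z + y' * (z - z')" by (simp add: algebra_simps)
    then have "\<bar>y * z - y' * z'\<bar> \<le> \<bar>y - y'\<bar> * \<bar>z\<bar> + \<bar>y'\<bar> * \<bar>z - z'\<bar>"
      by (metis abs_mult abs_triangle_ineq)
    also have "\<dots> \<le> e * (B + 1) + B * e"
      using that e B \<open>e \<le> 1\<close> by (intro add_mono mult_mono) auto
    finally show ?thesis by (simp add: algebra_simps)
  qed
  have 1: "\<bar>a * s - a' * s'\<bar> \<le> (2 * B + 1) * e" and 2: "\<bar>d * d - d' * d'\<bar> \<le> (2 * B + 1) * e"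
    and 3: "\<bar>s * s - s' * s'\<bar> \<le> (2 * B + 1) * e"
    using assms by (intro prod; simp)+
  have h: "0 \<le> h\<^sup>2 / 4" "h\<^sup>2 / 4 \<le> 1"
    using power_le_one[of h 2] assms by simp_all
  have "\<bar>h\<^sup>2 / 4 * (s * s - s' * s')\<bar> \<le> 1 * ((2 * B + 1) * e)"
    unfolding abs_mult using 3 h by (intro mult_mono) auto
  then have "\<bar>h\<^sup>2 * s\<^sup>2 / 4 - h\<^sup>2 * s'\<^sup>2 / 4\<bar> \<le> (2 * B + 1) * e"
    by (simp add: power2_eq_square algebra_simps diff_divide_distrib)
  moreover have "(6 * B + 3) * e = 3 * ((2 * B + 1) * e)"
    by (simp add: algebra_simps)
  ultimately show ?thesis
    using 1 2 unfolding power2_eq_square[of d] power2_eq_square[of d'] by linarith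
qed

text \<open>Here \<open>G (x + h) * G (x - h)\<close> equals the square of \<open>G x\<close> times
  \<open>exp (- h^2)\<close>, and \<open>1 - exp (- h^2)\<close> is at least \<open>h^2 / 2\<close>
  for \<open>h \<le> 1\<close>.\<close>

lemma gaussian_log_concavity_gap:
  fixes x h :: real
  assumes "0 < h" "h \<le> 1"
  defines "G \<equiv> \<lambda>x. sqrt (2 * pi) * exp (- (x\<^sup>2 / 2))"
  shows "h\<^sup>2 * (pi * exp (- x\<^sup>2)) \<le> (G x)\<^sup>2 - G (x + h) * G (x - h)"
proof -
  have GG: "G y * G z = 2 * pi * exp (- (y\<^sup>2 / 2) - z\<^sup>2 / 2)" for y z
  proof -
    have "G y * G z = (sqrt (2 * pi) * sqrt (2 * pi)) * (exp (- (y\<^sup>2 / 2)) * exp (- (z\<^sup>2 / 2)))"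
      by (simp only: G_def mult_ac)
    then show ?thesis by (simp only: real_sqrt_mult_self mult_exp_exp) simp
  qed
  have "- ((x + h)\<^sup>2 / 2) - (x - h)\<^sup>2 / 2 = - x\<^sup>2 - h\<^sup>2"
    by (simp add: power2_eq_square field_simps)
  then have "(G x)\<^sup>2 - G (x + h) * G (x - h) = 2 * pi * (exp (- x\<^sup>2) - exp (- x\<^sup>2 - h\<^sup>2))"
    unfolding power2_eq_square[of "G x"] GG by (simp add: right_diff_distrib)
  also have "\<dots> = 2 * pi * exp (- x\<^sup>2) * (1 - exp (- h\<^sup>2))"
    by (simp add: exp_diff exp_minus field_simps)
  finally have eq: "(G x)\<^sup>2 - G (x + h) * G (x - h) = 2 * pi * exp (- x\<^sup>2) * (1 - exp (- h\<^sup>2))" .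
  have "h\<^sup>2 \<le> 1" using assms by (simp add: power_le_one)
  have "exp (- h\<^sup>2) \<le> 1 / (1 + h\<^sup>2)"
    using exp_ge_add_one_self[of "h\<^sup>2"] by (simp add: exp_minus field_simps add_pos_nonneg)
  also have "\<dots> \<le> 1 - h\<^sup>2 / 2"
  proof -
    have "0 \<le> h\<^sup>2 * (1 - h\<^sup>2) / 2"
      using \<open>h\<^sup>2 \<le> 1\<close> by simp
    also have "\<dots> = (1 - h\<^sup>2 / 2) * (1 + h\<^sup>2) - 1"
      by (simp add: field_simps)
    finally show ?thesis
      by (simp add: divide_le_eq add_pos_nonneg)
  qed
  finally have "h\<^sup>2 / 2 \<le> 1 - exp (- h\<^sup>2)" by simp
  then have "2 * pi * exp (- x\<^sup>2) * (h\<^sup>2 / 2) \<le> 2 * pi * exp (- x\<^sup>2) * (1 - exp (- h\<^sup>2))"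
    by (intro mult_left_mono) auto
  then show ?thesis unfolding eq by (simp add: algebra_simps)
qed

text \<open>The kernel \<open>w\<close> will be a character or one of its two difference quotients.
  Integrability of \<open>\<Phi> t * w t\<close> comes from writing \<open>\<Phi>\<close> as the
  Gaussian plus an error that is integrable against the weight.\<close>

lemma fourier_perturbation:
  fixes \<Phi> w :: "real \<Rightarrow> complex"
  assumes [measurable]: "\<Phi> \<in> borel_measurable lborel" "w \<in> borel_measurable lborel"
    and int: "integrable lborel (\<lambda>t. (1 + t\<^sup>2) * norm (\<Phi> t - of_real (exp (- (t\<^sup>2 / 2)))))"
    and w: "\<And>t. norm (w t) \<le> 1 + t\<^sup>2"
  shows "integrable lborel (\<lambda>t. \<Phi> t * w t)"
    and "integrable lborel (\<lambda>t. of_real (exp (- (t\<^sup>2 / 2))) * w t)"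
    and "norm ((\<integral>t. \<Phi> t * w t \<partial>lborel) - (\<integral>t. of_real (exp (- (t\<^sup>2 / 2))) * w t \<partial>lborel))
      \<le> (\<integral>t. (1 + t\<^sup>2) * norm (\<Phi> t - of_real (exp (- (t\<^sup>2 / 2)))) \<partial>lborel)"
    and "norm (\<integral>t. of_real (exp (- (t\<^sup>2 / 2))) * w t \<partial>lborel)
      \<le> (\<integral>t. (1 + t\<^sup>2) * exp (- (t\<^sup>2 / 2)) \<partial>lborel)"
proof -
  let ?g = "\<lambda>t::real. complex_of_real (exp (- (t\<^sup>2 / 2)))"
  have bnd: "norm ((\<Phi> t - ?g t) * w t) \<le> (1 + t\<^sup>2) * norm (\<Phi> t - ?g t)" for t
    unfolding norm_mult mult.commute[of "norm (\<Phi> t - ?g t)"] using w by (intro mult_right_mono) auto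
  have gbnd: "norm (?g t * w t) \<le> (1 + t\<^sup>2) * exp (- (t\<^sup>2 / 2))" for t
    unfolding norm_mult mult.commute[of "norm (?g t)"] using w by (simp add: mult_right_mono)
  have diff: "integrable lborel (\<lambda>t. (\<Phi> t - ?g t) * w t)"
    by (rule Bochner_Integration.integrable_bound[OF int]) (use bnd in \<open>auto intro!: AE_I2 simp: order_trans[OF _ abs_ge_self]\<close>)
  show g: "integrable lborel (\<lambda>t. ?g t * w t)"
    by (rule Bochner_Integration.integrable_bound[OF integrable_gaussian_weight])
      (use gbnd in \<open>auto intro!: AE_I2 simp: order_trans[OF _ abs_ge_self]\<close>)
  show \<Phi>: "integrable lborel (\<lambda>t. \<Phi> t * w t)"
    using Bochner_Integration.integrable_add[OF diff g] by (simp add: algebra_simps)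
  have "(\<integral>t. \<Phi> t * w t \<partial>lborel) - (\<integral>t. ?g t * w t \<partial>lborel) = (\<integral>t. (\<Phi> t - ?g t) * w t \<partial>lborel)"
    by (subst Bochner_Integration.integral_diff[OF \<Phi> g, symmetric]) (simp add: algebra_simps)
  also have "norm \<dots> \<le> (\<integral>t. (1 + t\<^sup>2) * norm (\<Phi> t - ?g t) \<partial>lborel)"
    by (rule Bochner_Integration.integral_norm_bound_integral[OF diff int bnd])
  finally show "norm ((\<integral>t. \<Phi> t * w t \<partial>lborel) - (\<integral>t. ?g t * w t \<partial>lborel))
      \<le> (\<integral>t. (1 + t\<^sup>2) * norm (\<Phi> t - ?g t) \<partial>lborel)" .
  show "norm (\<integral>t. ?g t * w t \<partial>lborel) \<le> (\<integral>t. (1 + t\<^sup>2) * exp (- (t\<^sup>2 / 2)) \<partial>lborel)"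
    by (rule Bochner_Integration.integral_norm_bound_integral[OF g integrable_gaussian_weight gbnd])
qed

text \<open>Integrating against the difference-quotient kernels yields the difference quotients of
  \<open>a\<close>, \<open>p\<close>, \<open>m\<close>, so these and \<open>a\<close> lie within
  \<open>e\<close> of their Gaussian counterparts. The Gaussian gap divided by \<open>h^2\<close> is
  at least \<open>pi * exp (- x^2)\<close>, which absorbs the perturbation
  \<open>(6 * B + 3) * e\<close>.\<close>

lemma log_concave_of_gaussian_approx:
  fixes \<Phi> :: "real \<Rightarrow> complex" and x h a p m :: real
  assumes meas[measurable]: "\<Phi> \<in> borel_measurable lborel"
    and int: "integrable lborel (\<lambda>t. (1 + t\<^sup>2) * norm (\<Phi> t - of_real (exp (- (t\<^sup>2 / 2)))))"
    and h: "0 < h" "h \<le> 1"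
    and a: "(\<integral>t. \<Phi> t * cis (- (x * t)) \<partial>lborel) = of_real a"
    and p: "(\<integral>t. \<Phi> t * cis (- ((x + h) * t)) \<partial>lborel) = of_real p"
    and m: "(\<integral>t. \<Phi> t * cis (- ((x - h) * t)) \<partial>lborel) = of_real m"
  defines "B \<equiv> (\<integral>t. (1 + t\<^sup>2) * exp (- (t\<^sup>2 / 2)) \<partial>lborel)"
    and "e \<equiv> (\<integral>t. (1 + t\<^sup>2) * norm (\<Phi> t - of_real (exp (- (t\<^sup>2 / 2)))) \<partial>lborel)"
  assumes e: "e \<le> 1" "(6 * B + 3) * e \<le> pi * exp (- x\<^sup>2)"
  shows "p * m \<le> a\<^sup>2"
proof -
  define G where "G x = sqrt (2 * pi) * exp (- (x\<^sup>2 / 2))" for x :: real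
  let ?g = "\<lambda>t::real. complex_of_real (exp (- (t\<^sup>2 / 2)))"
  have norm1: "norm (cis (- (y * t))) \<le> 1 + t\<^sup>2" for y t :: real by simp
  have approx: "\<bar>r - s\<bar> \<le> e \<and> \<bar>s\<bar> \<le> B"
    if "w \<in> borel_measurable lborel" "\<And>t. norm (w t) \<le> 1 + t\<^sup>2"
      "(\<integral>t. \<Phi> t * w t \<partial>lborel) = of_real r" "(\<integral>t. ?g t * w t \<partial>lborel) = of_real s"
    for w and r s :: real
    using fourier_perturbation(3,4)[OF meas that(1) int that(2)] unfolding that(3,4)
    by (simp add: e_def B_def flip: of_real_diff)
  have cis_meas[measurable]: "(\<lambda>t. cis (- (y * t))) \<in> borel_measurable borel" for y
    by (intro borel_measurable_continuous_onI continuous_intros)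
  then have cis_meas': "(\<lambda>t. cis (- (y * t))) \<in> borel_measurable lborel" for y by simp
  note \<Phi>int = fourier_perturbation(1)[OF meas cis_meas' int norm1]
  note gint = fourier_perturbation(2)[OF meas cis_meas' int norm1]
  have g: "(\<integral>t. ?g t * cis (- (y * t)) \<partial>lborel) = of_real (G y)" for y
    unfolding G_def by (rule gaussian_fourier)
  have 1: "\<bar>a - G x\<bar> \<le> e \<and> \<bar>G x\<bar> \<le> B"
    using approx[OF _ norm1 a g] by simp
  let ?w = "\<lambda>t. (cis (- ((x + h) * t)) - cis (- ((x - h) * t))) / (2 * h)"
  \<comment> \<open>The function \<open>f\<close> is kept arbitrary because both
    \<open>\<Phi>\<close> and the Gaussian are inserted.\<close>
  have lin1: "(\<integral>t. f t * ?w t \<partial>lborel) = of_real ((q - r) / (2 * h))"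
    if "\<And>y. integrable lborel (\<lambda>t. f t * cis (- (y * t)))"
      "(\<integral>t. f t * cis (- ((x + h) * t)) \<partial>lborel) = of_real q"
      "(\<integral>t. f t * cis (- ((x - h) * t)) \<partial>lborel) = of_real r" for f and q r :: real
  proof -
    have "(\<integral>t. f t * ?w t \<partial>lborel)
        = (\<integral>t. (f t * cis (- ((x + h) * t)) - f t * cis (- ((x - h) * t))) / (2 * h) \<partial>lborel)"
      by (simp add: algebra_simps)
    also have "\<dots> = (of_real q - of_real r) / of_real (2 * h)"
      by (simp only: integral_divide_zero Bochner_Integration.integral_diff[OF that(1) that(1)] that(2,3))
    finally show ?thesis by simp
  qed
  define d D where "d = (p - m) / (2 * h)" and "D = (G (x + h) - G (x - h)) / (2 * h)"
  have 2: "\<bar>d - D\<bar> \<le> e \<and> \<bar>D\<bar> \<le> B"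
    unfolding d_def D_def
    by (rule approx[OF _ norm_cis_central_difference[OF h(1)] lin1[OF \<Phi>int p m] lin1[OF gint g g]])
      measurable
  let ?v = "\<lambda>t. (2 * cis (- (x * t)) - cis (- ((x + h) * t)) - cis (- ((x - h) * t))) / h\<^sup>2"
  have lin2: "(\<integral>t. f t * ?v t \<partial>lborel) = of_real ((2 * b - q - r) / h\<^sup>2)"
    if "\<And>y. integrable lborel (\<lambda>t. f t * cis (- (y * t)))"
      "(\<integral>t. f t * cis (- (x * t)) \<partial>lborel) = of_real b"
      "(\<integral>t. f t * cis (- ((x + h) * t)) \<partial>lborel) = of_real q"
      "(\<integral>t. f t * cis (- ((x - h) * t)) \<partial>lborel) = of_real r" for f and b q r :: real
  proof -
    have "(\<integral>t. f t * ?v t \<partial>lborel)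
        = (\<integral>t. (2 * (f t * cis (- (x * t))) - f t * cis (- ((x + h) * t)) - f t * cis (- ((x - h) * t))) / h\<^sup>2 \<partial>lborel)"
      by (simp add: algebra_simps)
    also have "\<dots> = (2 * of_real b - of_real q - of_real r) / of_real (h\<^sup>2)"
      by (simp only: integral_divide_zero Bochner_Integration.integral_diff[OF Bochner_Integration.integrable_diff[OF integrable_mult_right[OF that(1)] that(1)] that(1)]
          Bochner_Integration.integral_diff[OF integrable_mult_right[OF that(1)] that(1)] integral_mult_right_zero that(2-4))
    finally show ?thesis by simp
  qed
  define s S where "s = (2 * a - p - m) / h\<^sup>2" and "S = (2 * G x - G (x + h) - G (x - h)) / h\<^sup>2"
  have 3: "\<bar>s - S\<bar> \<le> e \<and> \<bar>S\<bar> \<le> B"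
    unfolding s_def S_def
    by (rule approx[OF _ norm_cis_second_difference[OF h(1)] lin2[OF \<Phi>int a p m] lin2[OF gint g g g]])
      measurable
  have "h\<^sup>2 * (pi * exp (- x\<^sup>2)) \<le> (G x)\<^sup>2 - G (x + h) * G (x - h)"
    unfolding G_def by (rule gaussian_log_concavity_gap[OF h])
  also have "\<dots> = h\<^sup>2 * (G x * S + D\<^sup>2 - h\<^sup>2 * S\<^sup>2 / 4)"
    unfolding S_def D_def by (rule log_concavity_gap[OF h(1)])
  \<comment> \<open>Cancelling \<open>h^2\<close> leaves a lower bound that does not shrink with the
    step.\<close>
  finally have "pi * exp (- x\<^sup>2) \<le> G x * S + D\<^sup>2 - h\<^sup>2 * S\<^sup>2 / 4"
    using h by simp
  moreover have "G x * S + D\<^sup>2 - h\<^sup>2 * S\<^sup>2 / 4 - (6 * B + 3) * e \<le> a * s + d\<^sup>2 - h\<^sup>2 * s\<^sup>2 / 4"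
    using 1 2 3 e(1) h by (intro log_concavity_gap_perturbation) auto
  ultimately have "0 \<le> a * s + d\<^sup>2 - h\<^sup>2 * s\<^sup>2 / 4"
    using e(2) by linarith
  then have "0 \<le> h\<^sup>2 * (a * s + d\<^sup>2 - h\<^sup>2 * s\<^sup>2 / 4)"
    by simp
  also have "\<dots> = a\<^sup>2 - p * m"
    unfolding s_def d_def by (rule log_concavity_gap[OF h(1), symmetric])
  finally show ?thesis by simp
qed

section \<open>The scaling limit\<close>

text \<open>The cutoff is the image of the period \<open>{-pi..pi}\<close> under
  \<open>t = inv_sd n * \<theta>\<close>; extension by zero turns integrals over the circle into
  integrals over the line.\<close>

definition scaled_inv_char :: "nat \<Rightarrow> real \<Rightarrow> complex" where
  "scaled_inv_char n t = indicator {-pi * inv_sd n..pi * inv_sd n} t *\<^sub>R inv_char n (t / inv_sd n)"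

lemma inv_sd_pos: "n > 0 \<Longrightarrow> inv_sd n > 0"
  by (simp add: inv_sd_def inv_variance_def)

lemma inv_sd_square: "(inv_sd n)\<^sup>2 = inv_variance n"
  by (simp add: inv_sd_def inv_variance_def)

lemma scaled_inv_char_measurable [measurable]: "scaled_inv_char n \<in> borel_measurable borel"
proof -
  have "(\<lambda>t. inv_char n (t / inv_sd n)) \<in> borel_measurable borel"
    unfolding inv_char_def ipoly_altdef divide_inverse
    by (intro borel_measurable_continuous_onI continuous_intros)
  then show ?thesis unfolding scaled_inv_char_def by measurable
qed

text \<open>Substitution of \<open>\<theta> = t / inv_sd n\<close> in
  \<open>central_qcoeff_integral\<close>. The factor before the coefficient is independent of
  \<open>j\<close>, and a change of \<open>j\<close> by one moves the frequency by
  \<open>1 / inv_sd n\<close>.\<close>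

lemma scaled_inv_char_fourier:
  assumes "n > 0"
  shows "(\<integral>t. scaled_inv_char n t * cis (- ((of_int j - inv_mean n) / inv_sd n * t)) \<partial>lborel)
    = of_real (2 * pi * inv_sd n / real ((2 * n) choose n) * of_int (central_qcoeff n j))"
proof -
  define s where "s = inv_sd n"
  have s: "s > 0" unfolding s_def using assms by (rule inv_sd_pos)
  let ?f = "\<lambda>\<theta>. indicator {-pi..pi} \<theta> *\<^sub>R (ipoly (qbinomial (2 * n) n) (cis \<theta>) * cis (- (of_int j * \<theta>)))"
  let ?g = "\<lambda>t. scaled_inv_char n t * cis (- ((of_int j - inv_mean n) / s * t))"
  have eq: "?f (t / s) = of_nat ((2 * n) choose n) * ?g t" for t
  proof -
    have "indicator {-pi..pi} (t / s) = (indicator {-pi * s..pi * s} t :: real)"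
      using s by (auto simp: indicator_def field_simps)
    moreover have "cis (- (of_int j * (t / s))) = cis (- (inv_mean n * (t / s))) * cis (- ((of_int j - inv_mean n) / s * t))"
      using s by (simp add: cis_mult field_simps)
    ultimately show ?thesis
      by (simp add: scaled_inv_char_def inv_char_def s_def[symmetric] mult.assoc)
  qed
  have "2 * pi * of_int (central_qcoeff n j) = (\<integral>\<theta>. ?f \<theta> \<partial>lborel)"
    by (rule central_qcoeff_integral [symmetric])
  also have "\<dots> = of_real (1 / s) * (\<integral>t. ?f (t / s) \<partial>lborel)"
    using lborel_integral_real_affine[of "1 / s" ?f 0] s by (simp add: scaleR_conv_of_real)
  also have "\<dots> = of_real (1 / s) * (of_nat ((2 * n) choose n) * (\<integral>t. ?g t \<partial>lborel))"
    by (simp only: eq integral_mult_right_zero)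
  finally show ?thesis
    using s unfolding s_def[symmetric] by (simp add: field_simps)
qed

text \<open>The deviation grows like \<open>n powr (3/2)\<close>. The limits serve, in order, the
  smallness of \<open>n * \<theta>\<close> at fixed \<open>t\<close>, the total error in
  \<open>inv_char_central\<close>, the step \<open>h\<close>, and the tail against a polynomial
  weight.\<close>

lemma inv_sd_growth:
  shows "(\<lambda>n. real n / inv_sd n) \<longlonglongrightarrow> 0"
    and "(\<lambda>n. real n * (real n / inv_sd n) ^ 4) \<longlonglongrightarrow> 0"
    and "(\<lambda>n. 1 / inv_sd n) \<longlonglongrightarrow> 0"
    and "(\<lambda>n. 2 * real n * (3 / 4) ^ n * (1 + (pi * inv_sd n)\<^sup>2)\<^sup>2) \<longlonglongrightarrow> 0"
  unfolding inv_sd_def inv_variance_def by real_asymp+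

text \<open>A majorant independent of \<open>n\<close>. The Gaussian covers
  \<open>n * \<bar>\<theta>\<bar> < pi\<close>. In the tail
  \<open>\<bar>t\<bar> \<le> pi * inv_sd n\<close>, so exponential decay in \<open>n\<close> is
  traded for decay in \<open>t\<close>; the squared denominator leaves an integrable function after
  multiplication by \<open>1 + t^2\<close>.\<close>

lemma scaled_inv_char_bound:
  obtains K where "K \<ge> 0"
    "\<And>n t. t \<noteq> 0 \<Longrightarrow> norm (scaled_inv_char n t) \<le> exp (- (t\<^sup>2 / 2)) + K / (1 + t\<^sup>2)\<^sup>2"
proof -
  obtain K where K: "K > 0" "\<And>n. norm (2 * real n * (3 / 4) ^ n * (1 + (pi * inv_sd n)\<^sup>2)\<^sup>2) \<le> K"
    using convergent_imp_Bseq[OF convergentI[OF inv_sd_growth(4)]] unfolding Bseq_def by blast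
  have "norm (scaled_inv_char n t) \<le> exp (- (t\<^sup>2 / 2)) + K / (1 + t\<^sup>2)\<^sup>2" if t: "t \<noteq> 0" for n t
  proof -
    have pos: "0 < 1 + t\<^sup>2" by (simp add: add_pos_nonneg)
    consider "pi * inv_sd n < \<bar>t\<bar>" | "\<bar>t\<bar> \<le> pi * inv_sd n" by linarith
    then show ?thesis
    proof cases
      case 1
      then have "scaled_inv_char n t = 0" by (auto simp: scaled_inv_char_def indicator_def)
      then show ?thesis using K(1) by (simp add: add_nonneg_nonneg)
    next
      case 2
      define \<theta> where "\<theta> = t / inv_sd n"
      \<comment> \<open>For \<open>n = 0\<close> the deviation is zero, which would force
        \<open>t = 0\<close>.\<close>
      have "n > 0" using 2 t by (cases "n = 0") (auto simp: inv_sd_def inv_variance_def)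
      then have s: "inv_sd n > 0" by (rule inv_sd_pos)
      with 2 have \<theta>: "\<theta> \<noteq> 0" "\<bar>\<theta>\<bar> \<le> pi" "inv_variance n * \<theta>\<^sup>2 = t\<^sup>2"
        using t by (auto simp: \<theta>_def field_simps inv_sd_square[symmetric])
      have eq: "scaled_inv_char n t = inv_char n \<theta>"
        using 2 by (auto simp: scaled_inv_char_def \<theta>_def indicator_def)
      show ?thesis
      proof (cases "n * \<bar>\<theta>\<bar> < pi")
        case True
        obtain r where "inv_char n \<theta> = of_real r" "0 \<le> r" "r \<le> exp (- (inv_variance n * \<theta>\<^sup>2 / 2))"
          using inv_char_central[OF \<theta>(1) True] by metis
        then have "norm (scaled_inv_char n t) \<le> exp (- (t\<^sup>2 / 2))"
          by (simp add: eq \<theta>(3))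
        then show ?thesis using K(1) by (simp add: add_increasing2)
      next
        case False
        then have "pi / n \<le> \<bar>\<theta>\<bar>" using \<open>n > 0\<close> by (simp add: field_simps)
        then have "norm (scaled_inv_char n t) \<le> 2 * real n * (3 / 4) ^ n"
          unfolding eq using \<open>n > 0\<close> \<theta>(2) by (intro norm_inv_char_tail)
        also have "\<dots> \<le> K / (1 + (pi * inv_sd n)\<^sup>2)\<^sup>2"
          using K(2)[of n] add_pos_nonneg[of 1 "(pi * inv_sd n)\<^sup>2"] by (simp add: pos_le_divide_eq)
        also have "\<dots> \<le> K / (1 + t\<^sup>2)\<^sup>2"
        proof -
          have "t\<^sup>2 \<le> (pi * inv_sd n)\<^sup>2" using 2 power_mono[of "\<bar>t\<bar>" "pi * inv_sd n" 2] by simp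
          then show ?thesis using K(1) pos by (intro divide_left_mono power_mono mult_pos_pos zero_less_power) auto
        qed
        finally show ?thesis by (simp add: add_increasing)
      qed
    qed
  qed
  with K(1) show thesis by (intro that[of K]) auto
qed

lemma scaled_inv_char_tendsto:
  assumes "t \<noteq> 0"
  shows "(\<lambda>n. norm (scaled_inv_char n t - of_real (exp (- (t\<^sup>2 / 2))))) \<longlonglongrightarrow> 0"
proof (rule tendsto_sandwich[where f = "\<lambda>_. 0"])
  \<comment> \<open>The error exponent of \<open>inv_char_central\<close> at
    \<open>\<theta> = t / inv_sd n\<close>.\<close>
  let ?\<delta> = "\<lambda>n. real n * (real n / inv_sd n) ^ 4 * \<bar>t\<bar> ^ 4 / 18"
  have "(\<lambda>n. real n / inv_sd n * \<bar>t\<bar>) \<longlonglongrightarrow> 0"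
    using tendsto_mult[OF inv_sd_growth(1) tendsto_const[of "\<bar>t\<bar>"]] by simp
  then have "eventually (\<lambda>n. real n / inv_sd n * \<bar>t\<bar> < 1) sequentially"
    by (rule order_tendstoD) simp
  then show "eventually (\<lambda>n. norm (scaled_inv_char n t - of_real (exp (- (t\<^sup>2 / 2))))
      \<le> exp (- (t\<^sup>2 / 2)) - exp (- (t\<^sup>2 / 2) - ?\<delta> n)) sequentially"
    using eventually_gt_at_top[of 0]
  proof eventually_elim
    case (elim n)
    define \<theta> where "\<theta> = t / inv_sd n"
    have s: "inv_sd n > 0" using elim(2) by (rule inv_sd_pos)
    have n\<theta>: "n * \<bar>\<theta>\<bar> = real n / inv_sd n * \<bar>t\<bar>"
      using s by (simp add: \<theta>_def)
    have \<theta>: "\<theta> \<noteq> 0" "n * \<bar>\<theta>\<bar> < 1" "inv_variance n * \<theta>\<^sup>2 = t\<^sup>2"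
      using assms s elim(1) n\<theta> by (auto simp: \<theta>_def field_simps inv_sd_square[symmetric])
    have "1 * \<bar>\<theta>\<bar> \<le> n * \<bar>\<theta>\<bar>" using elim(2) by (intro mult_right_mono) auto
    then have "\<bar>\<theta>\<bar> \<le> pi" "n * \<bar>\<theta>\<bar> < pi" using \<theta>(2) pi_gt3 by linarith+
    have "\<bar>t\<bar> \<le> pi * inv_sd n"
      using \<open>\<bar>\<theta>\<bar> \<le> pi\<close> s by (simp add: \<theta>_def divide_le_eq)
    then have eq: "scaled_inv_char n t = inv_char n \<theta>"
      by (auto simp: scaled_inv_char_def \<theta>_def indicator_def)
    obtain r where r: "inv_char n \<theta> = of_real r" "r \<le> exp (- (t\<^sup>2 / 2))"
      "exp (- (t\<^sup>2 / 2) - n * (n * \<bar>\<theta>\<bar>) ^ 4 / 18) \<le> r"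
      using inv_char_central[OF \<theta>(1) \<open>n * \<bar>\<theta>\<bar> < pi\<close>] \<theta>(2) unfolding \<theta>(3) by (metis less_imp_le)
    have "norm (scaled_inv_char n t - of_real (exp (- (t\<^sup>2 / 2)))) = \<bar>r - exp (- (t\<^sup>2 / 2))\<bar>"
      unfolding eq r(1) of_real_diff[symmetric] norm_of_real ..
    moreover have \<delta>: "n * (n * \<bar>\<theta>\<bar>) ^ 4 / 18 = ?\<delta> n"
      unfolding n\<theta> by (simp add: power_mult_distrib power_divide)
    ultimately show ?case using r(2) r(3)[unfolded \<delta>] by linarith
  qed
  have "(\<lambda>n. real n * (real n / inv_sd n) ^ 4 * (\<bar>t\<bar> ^ 4 / 18)) \<longlonglongrightarrow> 0 * (\<bar>t\<bar> ^ 4 / 18)"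
    by (intro tendsto_mult inv_sd_growth(2) tendsto_const)
  then have "(\<lambda>n. exp (- (t\<^sup>2 / 2)) - exp (- (t\<^sup>2 / 2) - ?\<delta> n)) \<longlonglongrightarrow> exp (- (t\<^sup>2 / 2)) - exp (- (t\<^sup>2 / 2) - 0)"
    by (intro tendsto_intros) simp
  then show "(\<lambda>n. exp (- (t\<^sup>2 / 2)) - exp (- (t\<^sup>2 / 2) - ?\<delta> n)) \<longlonglongrightarrow> 0"
    by simp
qed auto

lemma integrable_inverse_one_plus_square: "integrable lborel (\<lambda>t::real. inverse (1 + t\<^sup>2))"
  using integrable_inverse_1_plus_square by (simp add: set_integrable_def)

text \<open>Dominated convergence. The majorant \<open>w\<close> is the weight times the bound of
  \<open>scaled_inv_char_bound\<close>, with a second Gaussian for the subtracted term.\<close>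

lemma scaled_inv_char_L1:
  shows "integrable lborel (\<lambda>t. (1 + t\<^sup>2) * norm (scaled_inv_char n t - of_real (exp (- (t\<^sup>2 / 2)))))"
    and "(\<lambda>n. \<integral>t. (1 + t\<^sup>2) * norm (scaled_inv_char n t - of_real (exp (- (t\<^sup>2 / 2)))) \<partial>lborel) \<longlonglongrightarrow> 0"
proof -
  let ?s = "\<lambda>n t. (1 + t\<^sup>2) * norm (scaled_inv_char n t - of_real (exp (- (t\<^sup>2 / 2))))"
  obtain K where K: "K \<ge> 0"
    "\<And>n t. t \<noteq> 0 \<Longrightarrow> norm (scaled_inv_char n t) \<le> exp (- (t\<^sup>2 / 2)) + K / (1 + t\<^sup>2)\<^sup>2"
    using scaled_inv_char_bound by metis
  define w where "w t = 2 * ((1 + t\<^sup>2) * exp (- (t\<^sup>2 / 2))) + K * inverse (1 + t\<^sup>2)" for t :: real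
  have w: "integrable lborel w"
    unfolding w_def by (intro Bochner_Integration.integrable_add integrable_mult_right
        integrable_gaussian_weight integrable_inverse_one_plus_square)
  have bound: "norm (?s n t) \<le> w t" if "t \<noteq> 0" for n t
  proof -
    have pos: "0 < 1 + t\<^sup>2" by (simp add: add_pos_nonneg)
    have "norm (scaled_inv_char n t - of_real (exp (- (t\<^sup>2 / 2)))) \<le> 2 * exp (- (t\<^sup>2 / 2)) + K / (1 + t\<^sup>2)\<^sup>2"
      using norm_triangle_ineq4[of "scaled_inv_char n t" "of_real (exp (- (t\<^sup>2 / 2)))"] K(2)[OF that, of n] by simp
    then have "?s n t \<le> (1 + t\<^sup>2) * (2 * exp (- (t\<^sup>2 / 2)) + K / (1 + t\<^sup>2)\<^sup>2)"
      using pos by (intro mult_left_mono) auto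
    also have "\<dots> = w t"
    proof -
      have "y * (2 * g + K / y\<^sup>2) = 2 * (y * g) + K * inverse y" if "0 < y" for y g :: real
        using that by (simp add: field_simps power2_eq_square)
      from this[OF pos] show ?thesis unfolding w_def .
    qed
    finally show ?thesis using pos by simp
  qed
  \<comment> \<open>The pointwise bound and limit leave out \<open>t = 0\<close>, a null
    set.\<close>
  have AE0: "AE t in lborel. t \<noteq> (0::real)"
    by (rule AE_lborel_singleton)
  have AE_bound: "AE t in lborel. norm (?s n t) \<le> w t" for n
    using AE0 by eventually_elim (rule bound)
  have lim: "AE t in lborel. (\<lambda>n. ?s n t) \<longlonglongrightarrow> 0"
    using AE0
  proof eventually_elim
    case (elim t)
    show ?case
      using tendsto_mult[OF tendsto_const scaled_inv_char_tendsto[OF elim], of "1 + t\<^sup>2"] by simp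
  qed
  have meas: "?s n \<in> borel_measurable lborel" for n by measurable
  show "integrable lborel (?s n)" for n
    using integrable_dominated_convergence2[of "\<lambda>t. 0" lborel ?s w] w lim meas AE_bound by simp
  show "(\<lambda>n. \<integral>t. ?s n t \<partial>lborel) \<longlonglongrightarrow> 0"
    using integral_dominated_convergence[of "\<lambda>t. 0" lborel ?s w] w lim meas AE_bound by simp
qed

theorem theorem4p6:
  fixes C :: real
  shows "\<exists>n0::nat. \<forall>n\<ge>n0. \<forall>j::int.
           \<bar>real_of_int j - inv_mean n\<bar> \<le> C * inv_sd n \<longrightarrow>
           (central_qcoeff n j)\<^sup>2 \<ge> central_qcoeff n (j - 1) * central_qcoeff n (j + 1)"
proof -
  define B :: real where "B = (\<integral>t. (1 + t\<^sup>2) * exp (- (t\<^sup>2 / 2)) \<partial>lborel)"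
  define e where "e n = (\<integral>t. (1 + t\<^sup>2) * norm (scaled_inv_char n t - of_real (exp (- (t\<^sup>2 / 2)))) \<partial>lborel)" for n
  have e: "e \<longlonglongrightarrow> 0" unfolding e_def by (rule scaled_inv_char_L1(2))
  have "(\<lambda>n. (6 * B + 3) * e n) \<longlonglongrightarrow> 0"
    using tendsto_mult[OF tendsto_const e, of "6 * B + 3"] by simp
  \<comment> \<open>On the window \<open>\<bar>x\<bar> \<le> C\<close> the value
    \<open>exp (- C^2)\<close> bounds \<open>exp (- x^2)\<close> from below, so one threshold serves
    all \<open>j\<close>.\<close>
  then have "eventually (\<lambda>n. (6 * B + 3) * e n < pi * exp (- C\<^sup>2)) sequentially"
    by (rule order_tendstoD) simp
  moreover have "eventually (\<lambda>n. e n < 1) sequentially"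
    using e by (rule order_tendstoD) simp
  moreover have "eventually (\<lambda>n. 1 / inv_sd n < 1) sequentially"
    using inv_sd_growth(3) by (rule order_tendstoD) simp
  ultimately have "eventually (\<lambda>n. \<forall>j::int. \<bar>real_of_int j - inv_mean n\<bar> \<le> C * inv_sd n \<longrightarrow>
           (central_qcoeff n j)\<^sup>2 \<ge> central_qcoeff n (j - 1) * central_qcoeff n (j + 1)) sequentially"
    using eventually_gt_at_top[of 0]
  proof eventually_elim
    case (elim n)
    define s where "s = inv_sd n"
    \<comment> \<open>The factor from \<open>scaled_inv_char_fourier\<close>; it is common to the
      three coefficients and positive, so its square cancels at the end.\<close>
    define \<kappa> where "\<kappa> = 2 * pi * s / real ((2 * n) choose n)"
    have s: "s > 0" unfolding s_def using elim(4) by (rule inv_sd_pos)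
    have \<kappa>: "\<kappa> > 0" using s by (simp add: \<kappa>_def)
    show ?case
    proof (intro allI impI)
      fix j :: int
      assume j: "\<bar>real_of_int j - inv_mean n\<bar> \<le> C * inv_sd n"
      define x where "x = (real_of_int j - inv_mean n) / s"
      have "\<bar>x\<bar> \<le> C" using j s by (simp add: x_def s_def[symmetric] divide_le_eq)
      then have "x\<^sup>2 \<le> C\<^sup>2" using power_mono[of "\<bar>x\<bar>" C 2] by simp
      then have "pi * exp (- C\<^sup>2) \<le> pi * exp (- x\<^sup>2)" by simp
      \<comment> \<open>Neighbouring indices correspond to the step \<open>h = 1 / s\<close> in the
        rescaled frequency.\<close>
      have shift: "x + 1 / s = (real_of_int (j + 1) - inv_mean n) / s"
        "x - 1 / s = (real_of_int (j - 1) - inv_mean n) / s"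
        by (simp_all add: x_def add_divide_distrib diff_divide_distrib)
      note fourier = scaled_inv_char_fourier[OF elim(4), folded s_def, folded \<kappa>_def]
      have "(\<kappa> * central_qcoeff n (j + 1)) * (\<kappa> * central_qcoeff n (j - 1)) \<le> (\<kappa> * central_qcoeff n j)\<^sup>2"
      proof (rule log_concave_of_gaussian_approx)
        show "scaled_inv_char n \<in> borel_measurable lborel" by simp
        show "integrable lborel (\<lambda>t. (1 + t\<^sup>2) * norm (scaled_inv_char n t - of_real (exp (- (t\<^sup>2 / 2)))))"
          by (rule scaled_inv_char_L1(1))
        show "0 < 1 / s" "1 / s \<le> 1" using s elim(3) by (simp_all add: s_def)
        show "(\<integral>t. scaled_inv_char n t * cis (- (x * t)) \<partial>lborel) = of_real (\<kappa> * central_qcoeff n j)"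
          unfolding x_def by (rule fourier)
        show "(\<integral>t. scaled_inv_char n t * cis (- ((x + 1 / s) * t)) \<partial>lborel) = of_real (\<kappa> * central_qcoeff n (j + 1))"
          unfolding shift by (rule fourier)
        show "(\<integral>t. scaled_inv_char n t * cis (- ((x - 1 / s) * t)) \<partial>lborel) = of_real (\<kappa> * central_qcoeff n (j - 1))"
          unfolding shift by (rule fourier)
        show "(\<integral>t. (1 + t\<^sup>2) * norm (scaled_inv_char n t - of_real (exp (- (t\<^sup>2 / 2)))) \<partial>lborel) \<le> 1"
          using elim(2) by (simp add: e_def)
        show "(6 * (\<integral>t. (1 + t\<^sup>2) * exp (- (t\<^sup>2 / 2)) \<partial>lborel) + 3)
            * (\<integral>t. (1 + t\<^sup>2) * norm (scaled_inv_char n t - of_real (exp (- (t\<^sup>2 / 2)))) \<partial>lborel)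
            \<le> pi * exp (- x\<^sup>2)"
          using elim(1) \<open>pi * exp (- C\<^sup>2) \<le> pi * exp (- x\<^sup>2)\<close> unfolding e_def B_def by linarith
      qed
      then have "\<kappa>\<^sup>2 * real_of_int (central_qcoeff n (j - 1) * central_qcoeff n (j + 1))
          \<le> \<kappa>\<^sup>2 * real_of_int ((central_qcoeff n j)\<^sup>2)"
        by (simp add: power_mult_distrib power2_eq_square mult_ac)
      then show "(central_qcoeff n j)\<^sup>2 \<ge> central_qcoeff n (j - 1) * central_qcoeff n (j + 1)"
        using \<kappa> by (simp only: mult_le_cancel_left_pos zero_less_power of_int_le_iff)
    qed
  qed
  then show ?thesis unfolding eventually_sequentially .
qed

end
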